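(* Let $\mathcal{T}=(\mathbb{T},V,\xi)$ be a strict topological theory with $T1=1$. There is a natural transformation $\eta\colon\mathrm{Id}\Rightarrow\mathrm{pt}\cdot\Omega$ of endofunctors of $\mathcal{T}\text{-}\mathrm{Cat}$ with components $$\eta_X\colon X\to\mathrm{pt}(\Omega(X)),\quad x\mapsto\mathrm{ev}_{X,x},\qquad X\in\mathcal{T}\text{-}\mathrm{Cat},$$ where $\mathrm{ev}_{X,x}\colon\Omega(X)\to V$ is evaluation $\varphi\mapsto\varphi(x)$.
   Context: **Quantales and theories.** $V=(V,\bigvee,\otimes,k)$ is a commutative quantale: a complete lattice with a commutative associative operation $\otimes$ with unit $k$, preserving suprema in each variable; $\hom$ is defined by $x\otimes y\le z\iff x\le\hom(y,z)$. A strict topological theory $\mathcal{T}=(\mathbb{T},V,\xi)$ consists of a monad $\mathbb{T}=(T,m,e)$ on $\mathrm{Set}$, a commutative quantale $V$ and a map $\xi\colon TV\to V$ such that: (a) $T$ sends pullbacks to weak pullbacks and every naturality square of $m$ is a weak pullback; (b) $(V,\xi)$ is an Eilenberg–Moore $\mathbb{T}$-algebra, and $\otimes\colon V\times V\to V$ and $k\colon 1\to V$ are $\mathbb{T}$-homomorphisms, i.e. $\xi(T(\otimes)(w))=\xi(T\pi_1(w))\otimes\xi(T\pi_2(w))$ for $w\in T(V\times V)$ and $\xi(T(k)(t))=k$ for $t\in T1$; (c) the maps $\xi_X\colon V^X\to V^{TX}$, $\varphi\mapsto\xi\cdot T\varphi$ (on sets of functions, pointwise order) are monotone and natural: for $f\colon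 X\to Y$ and $\varphi\colon X\to V$, with $(P_Vf)(\varphi)(y)=\bigvee_{f(x)=y}\varphi(x)$, one has $\xi_Y(P_Vf(\varphi))=P_V(Tf)(\xi_X(\varphi))$. Here $T1=1$ means that $T$ of a one-element set is a one-element set. **Matrices.** A $V$-matrix $r\colon X\to Y$ is a map $r\colon Y\times X\to V$; matrices are ordered pointwise. Put $T_\xi r(\mathfrak{y},\mathfrak{x})=\bigvee\{\xi(Tr(w))\mid w\in T(Y\times X),T\pi_1(w)=\mathfrak{y},T\pi_2(w)=\mathfrak{x}\}$. **$\mathcal{T}$-graphs, categories, functors.** A $\mathcal{T}$-graph $(X,a)$ is a set with $a\colon TX\times X\to V$ such that $k\le a(e_X(x),x)$ for all $x$; it is a $\mathcal{T}$-category if also $T_\xi a(\mathfrak{X},\mathfrak{y})\otimes a(\mathfrak{y},x)\le a(m_X(\mathfrak{X}),x)$ for all $\mathfrak{X}\in TTX$, $\mathfrak{y}\in TX$, $x\in X$. A $\mathcal{T}$-graph morphism ($\mathcal{T}$-functor, between $\mathcal{T}$-categories) $f\colon(X,a)\to(Y,b)$ is a map with $a(\mathfrak{x},x)\le b(Tf(\mathfrak{x}),f(x))$. The underlying $V$-graph of $(X,a)$ is $X$ with $X(x',x)=a(e_X(x'),x)$. A $\mathbb{T}$-algebra $(I,\alpha)$ is viewed as a $\mathcal{T}$-category with structure $(\mathfrak{i},i)\mapsto k$ if $\alpha(\mathfrak{i})=i$, $\bot$ otherwise. $V$ is a $\mathcal{T}$-category with structure $(\mathfrak{v},v)\mapsto\hom(\xi(\mathfrak{v}),v)$.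 **$V$-categorical notions.** For $V$-categories (hom-objects $A(x,y)\in V$), a $V$-distributor $1\to A$ is a map $\varphi\colon A\to V$ with $A(x,y)\otimes\varphi(y)\le\varphi(x)$; $PA$ is the $V$-category of these with $PA(\varphi,\varphi')=\bigwedge_x\hom(\varphi(x),\varphi'(x))$. A $V$-distributor $I\to1$ is a map $\varphi\colon I\to V$ with $\varphi(i)\otimes I(i,j)\le\varphi(j)$. $\sup_A\varphi$ is an object with $A(\sup_A\varphi,y)=\bigwedge_x\hom(\varphi(x),A(x,y))$. For $\psi\colon1\to I$ and a $V$-functor $h\colon I\to A$, the colimit $c$ satisfies $A(c,y)=\bigwedge_i\hom(\psi(i),A(h(i),y))$; for $\varphi\colon I\to1$, $\lim(\varphi,h)$ satisfies $A(y,\lim(\varphi,h))=\bigwedge_i\hom(\varphi(i),A(y,h(i)))$. The tensor $v\otimes x$ satisfies $A(v\otimes x,y)=\hom(v,A(x,y))$. Such objects are unique up to isomorphism, and equalities between them are meant up to isomorphism. Complete means having all weighted limits (hence all weighted colimits). **$\mathcal{T}$-frames.** Let $A$ be a $\mathcal{T}$-graph whose underlying $V$-graph is a $V$-category with tensors (also denoted $A$). A $\mathcal{T}$-weighted diagram in $A$ is a set $I$ with a $\mathbb{T}$-algebra structure and a $V$-category structure, a $V$-functor $h\colon I\to A$ and a $V$-distributor $\psi\colon 1\to I$ such that $i\mapsto\psi(i)\otimes h(i)$ (for some choice of tensors) is a $\mathcal{T}$-graph morphism $I\to A$; its colimit is a $\mathcal{T}$-weighted colimit. A $V$-distributor $\varphi\colon1\to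 A$ is $\mathcal{T}$-generated if $\varphi(x)=\bigvee_iA(x,h(i))\otimes\psi(i)$ for such $h,\psi$. A $\mathcal{T}$-frame is a $\mathcal{T}$-graph $A$ whose underlying $V$-graph is a complete $V$-category such that for any $V$-category $I$, $V$-distributor $\varphi\colon I\to1$ and $V$-functor $h\colon I\to PA$ with all $h(i)$ $\mathcal{T}$-generated: if $\lim(\varphi,h)$ is $\mathcal{T}$-generated then $\sup_A(\lim(\varphi,h))=\lim(\varphi,\sup_A\cdot h)$. A $V$-functor $f\colon A\to B$ is $\mathcal{T}$-compatible if for each $\mathbb{T}$-algebra $I$ and $\mathcal{T}$-graph morphism $h\colon I\to A$, $f\cdot h$ is a $\mathcal{T}$-graph morphism. A $\mathcal{T}$-frame homomorphism is a $\mathcal{T}$-compatible $V$-functor between the underlying $V$-categories preserving weighted limits and $\mathcal{T}$-weighted colimits. These form the category $\mathcal{T}\text{-}\mathrm{Frm}$. $V$, with the $\mathcal{T}$-structure above, is a $\mathcal{T}$-frame. **$\Omega$ and $\mathrm{pt}$.** The functor $\Omega\colon(\mathcal{T}\text{-}\mathrm{Cat})^{\mathrm{op}}\to\mathcal{T}\text{-}\mathrm{Frm}$ sends a $\mathcal{T}$-category $X=(X,a)$ to the $\mathcal{T}$-frame $V^X$ of $\mathcal{T}$-functors $X\to V$, with $\mathcal{T}$-graph structure $(\mathfrak{p},\varphi)\mapsto\bigwedge\{\hom(a(T\pi_1(\mathfrak{q}),x),\hom(\xi(T\mathrm{ev}(\mathfrak{q})),\varphi(x)))\mid x\in X,\mathfrak{q}\in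 T(X\times V^X),T\pi_2(\mathfrak{q})=\mathfrak{p}\}$ ($\mathrm{ev}\colon X\times V^X\to V$ evaluation), whose underlying $V$-category has $[\varphi',\varphi]=\bigwedge_x\hom(\varphi'(x),\varphi(x))$; on a $\mathcal{T}$-functor $f$ it is $\varphi\mapsto\varphi\cdot f$. The functor $\mathrm{pt}\colon(\mathcal{T}\text{-}\mathrm{Frm})^{\mathrm{op}}\to\mathcal{T}\text{-}\mathrm{Cat}$ sends $A$ to the set $\mathcal{T}\text{-}\mathrm{Frm}(A,V)$ with the largest $\mathcal{T}$-category structure making all evaluation maps $h\mapsto h(x)$ ($x\in A$) $\mathcal{T}$-functors to $V$, and acts on morphisms by precomposition. *)

theory Defs
  imports Main "HOL-Library.FuncSet"
begin

section \<open>The category of sets\<close>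

text \<open>
  HOL cannot quantify over monads acting on all types, so the category Set is taken relative to a
  universe: a type whose elements are themselves sets, closed under the usual set-theoretic
  operations (extensionality, separation, replacement, union and power set; a universe of ZFC sets
  is an instance). The objects of Set are the small subsets of the universe, i.e. those that are
  the extension of an element; the maps from \<open>X\<close> to \<open>Y\<close> are the functions in \<open>X \<rightarrow> Y\<close>, two of
  them being the same map if they agree on \<open>X\<close>. Neither infinity nor foundation is assumed.
\<close>

class set_universe =
  fixes elts :: "'a \<Rightarrow> 'a set"
  assumes elts_inject: "elts x = elts y \<Longrightarrow> x = y"
    and elts_separation: "A \<subseteq> elts x \<Longrightarrow> A \<in> range elts"
    and elts_replacement: "f ` elts x \<in> range elts"
    and elts_Union: "(\<Union>y\<in>elts x. elts y) \<in> range elts"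
    and elts_Pow: "{y. elts y \<subseteq> elts x} \<in> range elts"

definition small :: "'u::set_universe set \<Rightarrow> bool" where
  "small A \<longleftrightarrow> A \<in> range elts"

definition mk :: "'u::set_universe set \<Rightarrow> 'u" where
  "mk A = (THE x. elts x = A)"

text \<open>Kuratowski pairs; functions with domain \<open>X\<close> are encoded by their graphs.\<close>

definition pair :: "'u::set_universe \<Rightarrow> 'u \<Rightarrow> 'u" where
  "pair x y = mk {mk {x}, mk {x, y}}"

definition prd :: "'u::set_universe set \<Rightarrow> 'u set \<Rightarrow> 'u set" where
  "prd X Y = {pair x y | x y. x \<in> X \<and> y \<in> Y}"

definition pi1 :: "'u::set_universe \<Rightarrow> 'u" where
  "pi1 p = (THE x. \<exists>y. p = pair x y)"

definition pi2 :: "'u::set_universe \<Rightarrow> 'u" where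
  "pi2 p = (THE y. \<exists>x. p = pair x y)"

definition fn :: "'u::set_universe set \<Rightarrow> ('u \<Rightarrow> 'u) \<Rightarrow> 'u" where
  "fn X f = mk ((\<lambda>x. pair x (f x)) ` X)"

definition app :: "'u::set_universe \<Rightarrow> 'u \<Rightarrow> 'u" where
  "app p x = (THE y. pair x y \<in> elts p)"

lemma elts_mk: "small A \<Longrightarrow> elts (mk A) = A"
  unfolding small_def mk_def
  by (rule theI') (auto dest: elts_inject)

lemma small_subset: "small A \<Longrightarrow> B \<subseteq> A \<Longrightarrow> small B"
  unfolding small_def using elts_separation by auto

lemma small_image:
  fixes f :: "'u::set_universe \<Rightarrow> 'u"
  shows "small A \<Longrightarrow> small (f ` A)"
  unfolding small_def using elts_replacement by auto

lemma small_doubleton: "small {x, y :: 'u::set_universe}"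
proof -
  define z :: 'u where "z = mk {}"
  have s0: "small ({} :: 'u set)"
    unfolding small_def using elts_separation[of "{}" undefined] by simp
  then have z: "elts z = {}"
    unfolding z_def by (rule elts_mk)
  define o1 where "o1 = mk {y. elts y \<subseteq> elts z}"
  have o1: "elts o1 = {y. elts y \<subseteq> elts z}"
    unfolding o1_def by (rule elts_mk) (simp add: small_def elts_Pow)
  have s: "small {y. elts y \<subseteq> elts o1}"
    by (simp add: small_def elts_Pow)
  have zz: "z \<in> elts o1"
    using o1 by simp
  have "{z, o1} \<subseteq> {y. elts y \<subseteq> elts o1}"
    using z by auto
  with s have "small {z, o1}"
    by (rule small_subset)
  then have "small ((\<lambda>w. if w = z then x else y) ` {z, o1})"
    by (rule small_image)
  moreover have "o1 \<noteq> z"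
    using zz z by auto
  ultimately show ?thesis
    by (simp add: insert_commute)
qed

lemma mk_inject: "small A \<Longrightarrow> small B \<Longrightarrow> mk A = mk B \<longleftrightarrow> A = B"
  using elts_mk by metis

lemma pair_inject [simp]: "pair x y = pair x' y' \<longleftrightarrow> x = x' \<and> y = y'"
proof -
  have s1: "small {a}" for a :: 'a
    using small_doubleton[of a a] by simp
  show ?thesis
    unfolding pair_def
    by (simp add: mk_inject small_doubleton s1 doubleton_eq_iff) (auto simp: mk_inject small_doubleton s1 doubleton_eq_iff singleton_insert_inj_eq)
qed

lemma pi1_pair [simp]: "pi1 (pair x y) = x"
  and pi2_pair [simp]: "pi2 (pair x y) = y"
  by (auto simp: pi1_def pi2_def)

lemma app_fn: "small X \<Longrightarrow> x \<in> X \<Longrightarrow> app (fn X f) x = f x"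
  unfolding app_def fn_def by (auto simp: elts_mk small_image)

definition is_pullback ::
  "'u set \<Rightarrow> 'u set \<Rightarrow> 'u set \<Rightarrow> ('u \<Rightarrow> 'u) \<Rightarrow> ('u \<Rightarrow> 'u) \<Rightarrow> ('u \<Rightarrow> 'u) \<Rightarrow> ('u \<Rightarrow> 'u) \<Rightarrow> bool" where
  "is_pullback P X Y p q f g \<longleftrightarrow>
     (\<forall>w\<in>P. p w \<in> X \<and> q w \<in> Y \<and> f (p w) = g (q w)) \<and>
     (\<forall>x\<in>X. \<forall>y\<in>Y. f x = g y \<longrightarrow> (\<exists>!w. w \<in> P \<and> p w = x \<and> q w = y))"

definition is_weak_pullback ::
  "'u set \<Rightarrow> 'u set \<Rightarrow> 'u set \<Rightarrow> ('u \<Rightarrow> 'u) \<Rightarrow> ('u \<Rightarrow> 'u) \<Rightarrow> ('u \<Rightarrow> 'u) \<Rightarrow> ('u \<Rightarrow> 'u) \<Rightarrow> bool" where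
  "is_weak_pullback P X Y p q f g \<longleftrightarrow>
     (\<forall>w\<in>P. p w \<in> X \<and> q w \<in> Y \<and> f (p w) = g (q w)) \<and>
     (\<forall>x\<in>X. \<forall>y\<in>Y. f x = g y \<longrightarrow> (\<exists>w\<in>P. p w = x \<and> q w = y))"


section \<open>Quantales and categories enriched in them\<close>

text \<open>The tensor is written \<open>*\<close> and its unit \<open>1\<close>.\<close>

class comm_quantale = complete_lattice + comm_monoid_mult +
  assumes mult_Sup: "x * Sup A = (SUP y\<in>A. x * y)"

definition qhom :: "'v::comm_quantale \<Rightarrow> 'v \<Rightarrow> 'v" where
  "qhom y z = Sup {x. x * y \<le> z}"

lemma qhom_adjoint: "x * y \<le> z \<longleftrightarrow> x \<le> qhom y (z :: 'v::comm_quantale)"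
proof
  assume "x * y \<le> z"
  then show "x \<le> qhom y z"
    unfolding qhom_def by (auto intro: Sup_upper)
next
  assume le: "x \<le> qhom y z"
  have "y * qhom y z \<le> z"
    unfolding qhom_def mult_Sup by (rule SUP_least) (simp add: mult.commute)
  moreover have "y * x \<le> y * qhom y z"
    using mult_Sup[of y "{x, qhom y z}"] le
    by (simp add: sup_absorb2) (metis sup.cobounded1)
  ultimately show "x * y \<le> z"
    by (metis mult.commute order_trans)
qed

text \<open>
  A V-category is given by its set of objects \<open>C\<close> and its hom-objects \<open>c x y\<close>. The type of objects
  is arbitrary, so that the V-category of presheaves, whose objects are functions, is covered too.
  Functions are relevant only on the carriers.
\<close>

definition vcat :: "'o set \<Rightarrow> ('o \<Rightarrow> 'o \<Rightarrow> 'v::comm_quantale) \<Rightarrow> bool" where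
  "vcat C c \<longleftrightarrow> (\<forall>x\<in>C. 1 \<le> c x x) \<and> (\<forall>x\<in>C. \<forall>y\<in>C. \<forall>z\<in>C. c x y * c y z \<le> c x z)"

definition vfunctor ::
  "'o set \<Rightarrow> ('o \<Rightarrow> 'o \<Rightarrow> 'v::comm_quantale) \<Rightarrow> 'p set \<Rightarrow> ('p \<Rightarrow> 'p \<Rightarrow> 'v) \<Rightarrow> ('o \<Rightarrow> 'p) \<Rightarrow> bool" where
  "vfunctor C c D d f \<longleftrightarrow> f \<in> C \<rightarrow> D \<and> (\<forall>x\<in>C. \<forall>y\<in>C. c x y \<le> d (f x) (f y))"

definition viso :: "('o \<Rightarrow> 'o \<Rightarrow> 'v::comm_quantale) \<Rightarrow> 'o \<Rightarrow> 'o \<Rightarrow> bool" where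
  "viso c x y \<longleftrightarrow> 1 \<le> c x y \<and> 1 \<le> c y x"

text \<open>Distributors from \<open>1\<close> to \<open>C\<close>, respectively from \<open>C\<close> to \<open>1\<close>.\<close>

definition dist_from_one :: "'o set \<Rightarrow> ('o \<Rightarrow> 'o \<Rightarrow> 'v::comm_quantale) \<Rightarrow> ('o \<Rightarrow> 'v) \<Rightarrow> bool" where
  "dist_from_one C c \<phi> \<longleftrightarrow> (\<forall>x\<in>C. \<forall>y\<in>C. c x y * \<phi> y \<le> \<phi> x)"

definition dist_to_one :: "'o set \<Rightarrow> ('o \<Rightarrow> 'o \<Rightarrow> 'v::comm_quantale) \<Rightarrow> ('o \<Rightarrow> 'v) \<Rightarrow> bool" where
  "dist_to_one C c \<phi> \<longleftrightarrow> (\<forall>x\<in>C. \<forall>y\<in>C. \<phi> x * c x y \<le> \<phi> y)"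

definition psh :: "'o set \<Rightarrow> ('o \<Rightarrow> 'o \<Rightarrow> 'v::comm_quantale) \<Rightarrow> ('o \<Rightarrow> 'v) set" where
  "psh C c = {\<phi>. dist_from_one C c \<phi>}"

definition psh_hom :: "'o set \<Rightarrow> ('o \<Rightarrow> 'v::comm_quantale) \<Rightarrow> ('o \<Rightarrow> 'v) \<Rightarrow> 'v" where
  "psh_hom C \<phi> \<phi>' = (INF x\<in>C. qhom (\<phi> x) (\<phi>' x))"

text \<open>
  Suprema, weighted (co)limits and tensors are determined only up to isomorphism, hence are
  rendered as relations; the last argument is the (co)limit object.
\<close>

definition is_sup :: "'o set \<Rightarrow> ('o \<Rightarrow> 'o \<Rightarrow> 'v::comm_quantale) \<Rightarrow> ('o \<Rightarrow> 'v) \<Rightarrow> 'o \<Rightarrow> bool" where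
  "is_sup C c \<phi> s \<longleftrightarrow> s \<in> C \<and> (\<forall>y\<in>C. c s y = (INF x\<in>C. qhom (\<phi> x) (c x y)))"

definition is_colim ::
  "'o set \<Rightarrow> ('o \<Rightarrow> 'o \<Rightarrow> 'v::comm_quantale) \<Rightarrow> 'i set \<Rightarrow> ('i \<Rightarrow> 'v) \<Rightarrow> ('i \<Rightarrow> 'o) \<Rightarrow> 'o \<Rightarrow> bool" where
  "is_colim C c I \<psi> h s \<longleftrightarrow> s \<in> C \<and> (\<forall>y\<in>C. c s y = (INF i\<in>I. qhom (\<psi> i) (c (h i) y)))"

definition is_lim ::
  "'o set \<Rightarrow> ('o \<Rightarrow> 'o \<Rightarrow> 'v::comm_quantale) \<Rightarrow> 'i set \<Rightarrow> ('i \<Rightarrow> 'v) \<Rightarrow> ('i \<Rightarrow> 'o) \<Rightarrow> 'o \<Rightarrow> bool" where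
  "is_lim C c I \<phi> h l \<longleftrightarrow> l \<in> C \<and> (\<forall>y\<in>C. c y l = (INF i\<in>I. qhom (\<phi> i) (c y (h i))))"

definition is_tensor ::
  "'o set \<Rightarrow> ('o \<Rightarrow> 'o \<Rightarrow> 'v::comm_quantale) \<Rightarrow> 'v \<Rightarrow> 'o \<Rightarrow> 'o \<Rightarrow> bool" where
  "is_tensor C c v x t \<longleftrightarrow> t \<in> C \<and> (\<forall>y\<in>C. c t y = qhom v (c x y))"

definition complete_vcat ::
  "'u::set_universe set \<Rightarrow> ('u \<Rightarrow> 'u \<Rightarrow> 'v::comm_quantale) \<Rightarrow> bool" where
  "complete_vcat C c \<longleftrightarrow> vcat C c \<and>
     (\<forall>(I :: 'u set) d \<phi> h. small I \<and> vcat I d \<and> dist_to_one I d \<phi> \<and> vfunctor I d C c h \<longrightarrow>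
        (\<exists>l. is_lim C c I \<phi> h l))"


section \<open>Strict topological theories\<close>

text \<open>
  \<open>Tmap X Y f\<close> is the action of the functor on a map \<open>f\<close> from \<open>X\<close> to \<open>Y\<close>.
  The quantale is given as a type \<open>'v\<close>; as the functor is applied to it, it also has to be an
  object of Set, and this object is the range of the injection \<open>enc\<close> into the universe.
\<close>

record ('u, 'v) theory_data =
  Tob :: "'u set \<Rightarrow> 'u set"
  Tmap :: "'u set \<Rightarrow> 'u set \<Rightarrow> ('u \<Rightarrow> 'u) \<Rightarrow> 'u \<Rightarrow> 'u"
  Tunit :: "'u set \<Rightarrow> 'u \<Rightarrow> 'u"
  Tmult :: "'u set \<Rightarrow> 'u \<Rightarrow> 'u"
  enc :: "'v \<Rightarrow> 'u"
  xi :: "'u \<Rightarrow> 'v"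

text \<open>\<open>str A \<xx> x\<close> is relevant only for \<open>\<xx>\<close> in \<open>T (carr A)\<close> and \<open>x\<close> in \<open>carr A\<close>.\<close>

record ('u, 'v) tgraph =
  carr :: "'u set"
  str :: "'u \<Rightarrow> 'u \<Rightarrow> 'v"

locale T_data =
  fixes \<T> :: "('u::set_universe, 'v::comm_quantale) theory_data"
begin

abbreviation "T \<equiv> Tob \<T>"
abbreviation "Tm \<equiv> Tmap \<T>"
abbreviation "e \<equiv> Tunit \<T>"
abbreviation "m \<equiv> Tmult \<T>"
abbreviation "\<xi> \<equiv> xi \<T>"
abbreviation "en \<equiv> enc \<T>"
abbreviation "de \<equiv> inv (enc \<T>)"
abbreviation VV :: "'u set" where "VV \<equiv> range (enc \<T>)"

definition set_monad :: bool where
  "set_monad \<longleftrightarrow>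
     (\<forall>X. small X \<longrightarrow> small (T X)) \<and>
     (\<forall>X Y f. small X \<and> small Y \<and> f \<in> X \<rightarrow> Y \<longrightarrow> Tm X Y f \<in> T X \<rightarrow> T Y) \<and>
     (\<forall>X Y f g. small X \<and> small Y \<and> f \<in> X \<rightarrow> Y \<and> (\<forall>x\<in>X. f x = g x) \<longrightarrow>
        (\<forall>t\<in>T X. Tm X Y f t = Tm X Y g t)) \<and>
     (\<forall>X. small X \<longrightarrow> (\<forall>t\<in>T X. Tm X X (\<lambda>x. x) t = t)) \<and>
     (\<forall>X Y Z f g. small X \<and> small Y \<and> small Z \<and> f \<in> X \<rightarrow> Y \<and> g \<in> Y \<rightarrow> Z \<longrightarrow>
        (\<forall>t\<in>T X. Tm X Z (\<lambda>x. g (f x)) t = Tm Y Z g (Tm X Y f t))) \<and>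
     (\<forall>X. small X \<longrightarrow> e X \<in> X \<rightarrow> T X) \<and>
     (\<forall>X Y f. small X \<and> small Y \<and> f \<in> X \<rightarrow> Y \<longrightarrow> (\<forall>x\<in>X. Tm X Y f (e X x) = e Y (f x))) \<and>
     (\<forall>X. small X \<longrightarrow> m X \<in> T (T X) \<rightarrow> T X) \<and>
     (\<forall>X Y f. small X \<and> small Y \<and> f \<in> X \<rightarrow> Y \<longrightarrow>
        (\<forall>t\<in>T (T X). Tm X Y f (m X t) = m Y (Tm (T X) (T Y) (Tm X Y f) t))) \<and>
     (\<forall>X. small X \<longrightarrow> (\<forall>t\<in>T X. m X (e (T X) t) = t \<and> m X (Tm X (T X) (e X) t) = t)) \<and>
     (\<forall>X. small X \<longrightarrow> (\<forall>t\<in>T (T (T X)). m X (m (T X) t) = m X (Tm (T (T X)) (T X) (m X) t)))"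

definition algebra :: "'u set \<Rightarrow> ('u \<Rightarrow> 'u) \<Rightarrow> bool" where
  "algebra I \<alpha> \<longleftrightarrow> small I \<and> \<alpha> \<in> T I \<rightarrow> I \<and> (\<forall>i\<in>I. \<alpha> (e I i) = i) \<and>
     (\<forall>t\<in>T (T I). \<alpha> (m I t) = \<alpha> (Tm (T I) I \<alpha> t))"

definition beck_chevalley :: bool where
  "beck_chevalley \<longleftrightarrow>
     (\<forall>P X Y Z p q f g. small P \<and> small X \<and> small Y \<and> small Z \<and>
        f \<in> X \<rightarrow> Z \<and> g \<in> Y \<rightarrow> Z \<and> is_pullback P X Y p q f g \<longrightarrow>
        is_weak_pullback (T P) (T X) (T Y) (Tm P X p) (Tm P Y q) (Tm X Z f) (Tm Y Z g)) \<and>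
     (\<forall>X Y f. small X \<and> small Y \<and> f \<in> X \<rightarrow> Y \<longrightarrow>
        is_weak_pullback (T (T X)) (T X) (T (T Y))
          (m X) (Tm (T X) (T Y) (Tm X Y f)) (Tm X Y f) (m Y))"

text \<open>\<open>\<xi>ext X \<phi>\<close> is the map \<open>\<xi>\<^sub>X(\<phi>) = \<xi> \<cdot> T\<phi>\<close>.\<close>

definition \<xi>ext :: "'u set \<Rightarrow> ('u \<Rightarrow> 'v) \<Rightarrow> 'u \<Rightarrow> 'v" where
  "\<xi>ext X \<phi> t = \<xi> (Tm X VV (\<lambda>x. en (\<phi> x)) t)"

definition strict_theory :: bool where
  "strict_theory \<longleftrightarrow>
     inj en \<and> small VV \<and> set_monad \<and> beck_chevalley \<and>
     algebra VV (\<lambda>t. en (\<xi> t)) \<and>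
     (\<forall>w\<in>T (prd VV VV). \<xi>ext (prd VV VV) (\<lambda>p. de (pi1 p) * de (pi2 p)) w =
        \<xi> (Tm (prd VV VV) VV pi1 w) * \<xi> (Tm (prd VV VV) VV pi2 w)) \<and>
     (\<forall>z. \<forall>t\<in>T {z}. \<xi>ext {z} (\<lambda>_. 1) t = 1) \<and>
     (\<forall>X \<phi> \<phi>'. small X \<and> (\<forall>x\<in>X. \<phi> x \<le> \<phi>' x) \<longrightarrow> (\<forall>t\<in>T X. \<xi>ext X \<phi> t \<le> \<xi>ext X \<phi>' t)) \<and>
     (\<forall>X Y f \<phi>. small X \<and> small Y \<and> f \<in> X \<rightarrow> Y \<longrightarrow>
        (\<forall>t\<in>T Y. \<xi>ext Y (\<lambda>y. Sup {\<phi> x | x. x \<in> X \<and> f x = y}) t =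
           Sup {\<xi>ext X \<phi> s | s. s \<in> T X \<and> Tm X Y f s = t}))"

definition T_one_eq_one :: bool where
  "T_one_eq_one \<longleftrightarrow> (\<forall>z. \<exists>t. T {z} = {t})"

definition Txi :: "'u set \<Rightarrow> 'u set \<Rightarrow> ('u \<Rightarrow> 'u \<Rightarrow> 'v) \<Rightarrow> 'u \<Rightarrow> 'u \<Rightarrow> 'v" where
  "Txi Y X r \<yy> \<xx> =
     Sup {\<xi>ext (prd Y X) (\<lambda>p. r (pi1 p) (pi2 p)) w | w.
        w \<in> T (prd Y X) \<and> Tm (prd Y X) Y pi1 w = \<yy> \<and> Tm (prd Y X) X pi2 w = \<xx>}"


subsection \<open>Graphs, categories, functors\<close>

definition tgraph :: "('u, 'v) tgraph \<Rightarrow> bool" where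
  "tgraph A \<longleftrightarrow> small (carr A) \<and> (\<forall>x\<in>carr A. 1 \<le> str A (e (carr A) x) x)"

definition tcat :: "('u, 'v) tgraph \<Rightarrow> bool" where
  "tcat A \<longleftrightarrow> tgraph A \<and>
     (\<forall>\<XX>\<in>T (T (carr A)). \<forall>\<yy>\<in>T (carr A). \<forall>x\<in>carr A.
        Txi (T (carr A)) (carr A) (str A) \<XX> \<yy> * str A \<yy> x \<le> str A (m (carr A) \<XX>) x)"

definition tmor :: "('u, 'v) tgraph \<Rightarrow> ('u, 'v) tgraph \<Rightarrow> ('u \<Rightarrow> 'u) \<Rightarrow> bool" where
  "tmor A B f \<longleftrightarrow> f \<in> carr A \<rightarrow> carr B \<and>
     (\<forall>\<xx>\<in>T (carr A). \<forall>x\<in>carr A. str A \<xx> x \<le> str B (Tm (carr A) (carr B) f \<xx>) (f x))"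

definition und :: "('u, 'v) tgraph \<Rightarrow> 'u \<Rightarrow> 'u \<Rightarrow> 'v" where
  "und A x' x = str A (e (carr A) x') x"

definition alg_graph :: "'u set \<Rightarrow> ('u \<Rightarrow> 'u) \<Rightarrow> ('u, 'v) tgraph" where
  "alg_graph I \<alpha> = \<lparr>carr = I, str = (\<lambda>\<ii> i. if \<alpha> \<ii> = i then 1 else bot)\<rparr>"

definition Vobj :: "('u, 'v) tgraph" where
  "Vobj = \<lparr>carr = VV, str = (\<lambda>\<vv> v. qhom (\<xi> \<vv>) (de v))\<rparr>"


subsection \<open>Frames\<close>

definition weighted_diagram ::
  "('u, 'v) tgraph \<Rightarrow> 'u set \<Rightarrow> ('u \<Rightarrow> 'u) \<Rightarrow> ('u \<Rightarrow> 'u \<Rightarrow> 'v) \<Rightarrow> ('u \<Rightarrow> 'u) \<Rightarrow> ('u \<Rightarrow> 'v) \<Rightarrow> bool" where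
  "weighted_diagram A I \<alpha> d h \<psi> \<longleftrightarrow>
     algebra I \<alpha> \<and> vcat I d \<and> vfunctor I d (carr A) (und A) h \<and> dist_from_one I d \<psi> \<and>
     (\<exists>t. (\<forall>i\<in>I. is_tensor (carr A) (und A) (\<psi> i) (h i) (t i)) \<and> tmor (alg_graph I \<alpha>) A t)"

definition t_generated :: "('u, 'v) tgraph \<Rightarrow> ('u \<Rightarrow> 'v) \<Rightarrow> bool" where
  "t_generated A \<phi> \<longleftrightarrow> dist_from_one (carr A) (und A) \<phi> \<and>
     (\<exists>I \<alpha> d h \<psi>. weighted_diagram A I \<alpha> d h \<psi> \<and>
        (\<forall>x\<in>carr A. \<phi> x = (SUP i\<in>I. und A x (h i) * \<psi> i)))"

text \<open>
  In the last condition \<open>l\<close> is the limit of \<open>h\<close> in the presheaf category, \<open>s\<close> its supremum,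
  \<open>\<sigma> i\<close> the supremum of \<open>h i\<close> and \<open>r\<close> the limit of these suprema.
\<close>

definition tframe :: "('u, 'v) tgraph \<Rightarrow> bool" where
  "tframe A \<longleftrightarrow> tgraph A \<and> complete_vcat (carr A) (und A) \<and>
     (\<forall>(I :: 'u set) d \<phi> h l s \<sigma> r.
        small I \<and> vcat I d \<and> dist_to_one I d \<phi> \<and>
        vfunctor I d (psh (carr A) (und A)) (psh_hom (carr A)) h \<and>
        (\<forall>i\<in>I. t_generated A (h i)) \<and>
        is_lim (psh (carr A) (und A)) (psh_hom (carr A)) I \<phi> h l \<and> t_generated A l \<and>
        is_sup (carr A) (und A) l s \<and>
        (\<forall>i\<in>I. is_sup (carr A) (und A) (h i) (\<sigma> i)) \<and>
        is_lim (carr A) (und A) I \<phi> \<sigma> r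
        \<longrightarrow> viso (und A) s r)"

definition compatible :: "('u, 'v) tgraph \<Rightarrow> ('u, 'v) tgraph \<Rightarrow> ('u \<Rightarrow> 'u) \<Rightarrow> bool" where
  "compatible A B f \<longleftrightarrow>
     (\<forall>I \<alpha> h. algebra I \<alpha> \<and> tmor (alg_graph I \<alpha>) A h \<longrightarrow> tmor (alg_graph I \<alpha>) B (\<lambda>i. f (h i)))"

definition frame_hom :: "('u, 'v) tgraph \<Rightarrow> ('u, 'v) tgraph \<Rightarrow> ('u \<Rightarrow> 'u) \<Rightarrow> bool" where
  "frame_hom A B f \<longleftrightarrow> tframe A \<and> tframe B \<and>
     vfunctor (carr A) (und A) (carr B) (und B) f \<and> compatible A B f \<and>
     (\<forall>(I :: 'u set) d \<phi> h l.
        small I \<and> vcat I d \<and> dist_to_one I d \<phi> \<and> vfunctor I d (carr A) (und A) h \<and>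
        is_lim (carr A) (und A) I \<phi> h l \<longrightarrow>
        is_lim (carr B) (und B) I \<phi> (\<lambda>i. f (h i)) (f l)) \<and>
     (\<forall>I \<alpha> d h \<psi> c.
        weighted_diagram A I \<alpha> d h \<psi> \<and> is_colim (carr A) (und A) I \<psi> h c \<longrightarrow>
        is_colim (carr B) (und B) I \<psi> (\<lambda>i. f (h i)) (f c))"


subsection \<open>The functors \<open>\<Omega>\<close> and \<open>pt\<close>\<close>

definition Omega :: "('u, 'v) tgraph \<Rightarrow> ('u, 'v) tgraph" where
  "Omega X =
    (let F = {fn (carr X) \<phi> | \<phi>. tmor X Vobj \<phi>} in
     \<lparr>carr = F,
      str = (\<lambda>\<pp> \<phi>.
        Inf {qhom (str X (Tm (prd (carr X) F) (carr X) pi1 \<qq>) x)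
              (qhom (\<xi> (Tm (prd (carr X) F) VV (\<lambda>p. app (pi2 p) (pi1 p)) \<qq>)) (de (app \<phi> x)))
          | x \<qq>. x \<in> carr X \<and> \<qq> \<in> T (prd (carr X) F) \<and> Tm (prd (carr X) F) F pi2 \<qq> = \<pp>})\<rparr>)"

definition Omega_map :: "('u, 'v) tgraph \<Rightarrow> ('u \<Rightarrow> 'u) \<Rightarrow> 'u \<Rightarrow> 'u" where
  "Omega_map X f \<phi> = fn (carr X) (\<lambda>x. app \<phi> (f x))"

definition pt_carr :: "('u, 'v) tgraph \<Rightarrow> 'u set" where
  "pt_carr A = {fn (carr A) h | h. frame_hom A Vobj h}"

definition pt_admissible :: "('u, 'v) tgraph \<Rightarrow> ('u \<Rightarrow> 'u \<Rightarrow> 'v) \<Rightarrow> bool" where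
  "pt_admissible A c \<longleftrightarrow> tcat \<lparr>carr = pt_carr A, str = c\<rparr> \<and>
     (\<forall>x\<in>carr A. tmor \<lparr>carr = pt_carr A, str = c\<rparr> Vobj (\<lambda>h. app h x))"

text \<open>The largest structure is unique where it is relevant, so that the choice is immaterial.\<close>

definition pt :: "('u, 'v) tgraph \<Rightarrow> ('u, 'v) tgraph" where
  "pt A = \<lparr>carr = pt_carr A,
     str = (SOME c. pt_admissible A c \<and>
       (\<forall>c'. pt_admissible A c' \<longrightarrow> (\<forall>\<pp>\<in>T (pt_carr A). \<forall>h\<in>pt_carr A. c' \<pp> h \<le> c \<pp> h)))\<rparr>"

text \<open>For \<open>g\<close> from \<open>A\<close> to \<open>B\<close>, \<open>pt_map A g\<close> goes from \<open>pt B\<close> to \<open>pt A\<close>.\<close>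

definition pt_map :: "('u, 'v) tgraph \<Rightarrow> ('u \<Rightarrow> 'u) \<Rightarrow> 'u \<Rightarrow> 'u" where
  "pt_map A g h = fn (carr A) (\<lambda>x. app h (g x))"


subsection \<open>Natural transformations\<close>

text \<open>
  An endofunctor of the category of \<open>\<T>\<close>-categories consists of an action \<open>F\<close> on objects and
  an action \<open>F' X Y\<close> on maps from \<open>X\<close> to \<open>Y\<close>. The second condition says that \<open>F'\<close> is well defined
  on maps, which are functions up to agreement on the carrier.
\<close>

definition endofunctor ::
  "(('u, 'v) tgraph \<Rightarrow> ('u, 'v) tgraph) \<Rightarrow>
   (('u, 'v) tgraph \<Rightarrow> ('u, 'v) tgraph \<Rightarrow> ('u \<Rightarrow> 'u) \<Rightarrow> 'u \<Rightarrow> 'u) \<Rightarrow> bool" where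
  "endofunctor F F' \<longleftrightarrow>
     (\<forall>X. tcat X \<longrightarrow> tcat (F X)) \<and>
     (\<forall>X Y f g. tcat X \<and> tcat Y \<and> tmor X Y f \<and> tmor X Y g \<and> (\<forall>x\<in>carr X. f x = g x) \<longrightarrow>
        (\<forall>p\<in>carr (F X). F' X Y f p = F' X Y g p)) \<and>
     (\<forall>X Y f. tcat X \<and> tcat Y \<and> tmor X Y f \<longrightarrow> tmor (F X) (F Y) (F' X Y f)) \<and>
     (\<forall>X. tcat X \<longrightarrow> (\<forall>p\<in>carr (F X). F' X X (\<lambda>x. x) p = p)) \<and>
     (\<forall>X Y Z f g. tcat X \<and> tcat Y \<and> tcat Z \<and> tmor X Y f \<and> tmor Y Z g \<longrightarrow>
        (\<forall>p\<in>carr (F X). F' X Z (\<lambda>x. g (f x)) p = F' Y Z g (F' X Y f p)))"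

definition natural_transformation ::
  "(('u, 'v) tgraph \<Rightarrow> ('u, 'v) tgraph) \<Rightarrow>
   (('u, 'v) tgraph \<Rightarrow> ('u, 'v) tgraph \<Rightarrow> ('u \<Rightarrow> 'u) \<Rightarrow> 'u \<Rightarrow> 'u) \<Rightarrow>
   (('u, 'v) tgraph \<Rightarrow> ('u, 'v) tgraph) \<Rightarrow>
   (('u, 'v) tgraph \<Rightarrow> ('u, 'v) tgraph \<Rightarrow> ('u \<Rightarrow> 'u) \<Rightarrow> 'u \<Rightarrow> 'u) \<Rightarrow>
   (('u, 'v) tgraph \<Rightarrow> 'u \<Rightarrow> 'u) \<Rightarrow> bool" where
  "natural_transformation F F' G G' \<eta> \<longleftrightarrow>
     endofunctor F F' \<and> endofunctor G G' \<and>
     (\<forall>X. tcat X \<longrightarrow> tmor (F X) (G X) (\<eta> X)) \<and>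
     (\<forall>X Y f. tcat X \<and> tcat Y \<and> tmor X Y f \<longrightarrow>
        (\<forall>x\<in>carr (F X). \<eta> Y (F' X Y f x) = G' X Y f (\<eta> X x)))"

end

end

theory Submission
  imports Defs
begin

text \<open>
  Evaluation at \<open>x\<close> on \<open>\<Omega> X\<close> is representable, by the functor \<open>y \<mapsto> a(e x, y)\<close>, and limits, tensors
  and \<open>\<T>\<close>-weighted colimits in \<open>\<Omega> X\<close> are computed pointwise: for limits and tensors because
  \<open>T 1 = 1\<close> makes \<open>\<xi>\<close> preserve constants, for colimits because \<open>\<xi>\<close> commutes with suprema along
  fibres. These two properties already imply the frame axiom: the supremum of a \<open>\<T>\<close>-generated
  presheaf at \<open>x\<close> is the value of the presheaf at the object representing evaluation at \<open>x\<close>, and limits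
  of presheaves are computed pointwise. Any graph morphism that is compatible with evaluations is then
  a frame homomorphism, in particular \<open>ev\<^sub>x\<close> and \<open>\<Omega> f\<close>. Finally, the structure of \<open>pt A\<close> is the
  initial one with respect to the evaluations, so that a map into it is a functor as soon as its
  composites with the evaluations are.
\<close>

section \<open>Quantales and small sets\<close>

lemma le_qhom: "u \<le> qhom y (z :: 'v::comm_quantale) \<longleftrightarrow> u * y \<le> z"
  by (simp add: qhom_adjoint)

lemma quantale_mult_mono:
  fixes x y :: "'v::comm_quantale"
  assumes "x \<le> x'" "y \<le> y'"
  shows "x * y \<le> x' * y'"
proof -
  have *: "a * c \<le> b * c" if "a \<le> b" for a b c :: 'v
    using that order_trans[of a b "qhom c (b * c)"] qhom_adjoint[of b c] qhom_adjoint[of a c] by auto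
  show ?thesis
    using *[OF assms(1), of y] *[OF assms(2), of x'] by (simp add: mult.commute)
qed

lemma qhom_one [simp]: "qhom 1 (z :: 'v::comm_quantale) = z"
  by (rule antisym) (metis le_qhom mult_1_right order_refl, simp add: le_qhom)

lemma mult_SUP: "x * (SUP i\<in>I. f i) = (SUP i\<in>I. x * (f i :: 'v::comm_quantale))"
  by (simp add: mult_Sup image_image)

text \<open>Hom-objects are compared through this: by the adjunction of \<open>qhom\<close>, a lower
  bound of an infimum of homs amounts to a family of inequalities between products, so an equality
  reduces to the equivalence of two such families.\<close>

lemma eq_if_same_lower_bounds:
  fixes a b :: "'a::order"
  shows "(\<And>u. u \<le> a \<longleftrightarrow> u \<le> b) \<Longrightarrow> a = b"
  by (meson antisym order_refl)

text \<open>The union axiom speaks of the elements of a single element of the universe, so the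
  family is first collected by replacement into the image of
  \<open>\<lambda>i. mk (B i)\<close>.\<close>

lemma small_UN:
  fixes B :: "'u \<Rightarrow> 'u::set_universe set"
  assumes "small I" "\<And>i. i \<in> I \<Longrightarrow> small (B i)"
  shows "small (\<Union>i\<in>I. B i)"
proof -
  have "small ((\<lambda>i. mk (B i)) ` I)"
    using assms(1) by (rule small_image)
  then obtain z where z: "elts z = (\<lambda>i. mk (B i)) ` I"
    unfolding small_def by (metis rangeE)
  have "(\<Union>y\<in>elts z. elts y) = (\<Union>i\<in>I. B i)"
    unfolding z using assms(2) by (simp add: elts_mk)
  then show ?thesis
    using elts_Union[of z] by (simp add: small_def)
qed

lemma small_singleton: "small {x :: 'u::set_universe}"
  using small_doubleton[of x x] by simp

lemma prd_eq: "prd X Y = (\<Union>x\<in>X. pair x ` Y)"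
  by (auto simp: prd_def)

lemma small_prd: "small X \<Longrightarrow> small Y \<Longrightarrow> small (prd X Y)"
  unfolding prd_eq by (intro small_UN small_image)

lemma pair_in_prd [simp]: "pair x y \<in> prd X Y \<longleftrightarrow> x \<in> X \<and> y \<in> Y"
  by (auto simp: prd_def)

lemma prdE:
  assumes "p \<in> prd X Y"
  obtains x y where "p = pair x y" "x \<in> X" "y \<in> Y"
  using assms by (auto simp: prd_def)

lemma pi1_in: "pi1 \<in> prd X Y \<rightarrow> X"
  and pi2_in: "pi2 \<in> prd X Y \<rightarrow> Y"
  by (auto simp: prd_def)

lemma fn_cong: "(\<And>x. x \<in> X \<Longrightarrow> f x = g x) \<Longrightarrow> fn X f = fn X g"
  unfolding fn_def by (metis (mono_tags, lifting) image_cong)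

text \<open>The graph of a map from \<open>X\<close> to \<open>Y\<close> is a subset of
  \<open>prd X Y\<close>, so all the codes lie in a power set. This bounds the carriers of
  \<open>Omega\<close> and \<open>pt\<close>.\<close>

lemma small_fn_space:
  assumes "small X" "small Y"
  shows "small {fn X f | f. f \<in> X \<rightarrow> Y}"
proof -
  obtain z where z: "elts z = prd X Y"
    using small_prd[OF assms] unfolding small_def by (metis rangeE)
  have "small {y. elts y \<subseteq> prd X Y}"
    using elts_Pow[of z] by (simp add: small_def z)
  moreover have "{fn X f | f. f \<in> X \<rightarrow> Y} \<subseteq> {y. elts y \<subseteq> prd X Y}"
    using assms(1) by (auto simp: fn_def elts_mk small_image Pi_iff)
  ultimately show ?thesis
    by (rule small_subset)
qed


section \<open>Calculus of the map \<open>\<xi>\<close>\<close>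

lemma vfunctor_comp:
  assumes f: "vfunctor C c D d f" and g: "vfunctor D d E d' g"
  shows "vfunctor C c E d' (\<lambda>x. g (f x))"
  unfolding vfunctor_def
proof (intro conjI ballI)
  show "(\<lambda>x. g (f x)) \<in> C \<rightarrow> E"
    using f g by (auto simp: vfunctor_def)
  fix x y assume "x \<in> C" "y \<in> C"
  then have "c x y \<le> d (f x) (f y)" "d (f x) (f y) \<le> d' (g (f x)) (g (f y))"
    using f g by (auto simp: vfunctor_def Pi_iff)
  then show "c x y \<le> d' (g (f x)) (g (f y))"
    by (rule order_trans)
qed

locale strict_topological_theory = T_data \<T>
  for \<T> :: "('u::set_universe, 'v::comm_quantale) theory_data" +
  assumes strict: strict_theory
    and T_one: T_one_eq_one
begin

section \<open>Laws of the monad and lifting along weak pullbacks\<close>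

lemma inj_en: "inj en"
  and small_VV: "small VV"
  and monad: set_monad
  and bc: beck_chevalley
  and alg_VV: "algebra VV (\<lambda>t. en (\<xi> t))"
  using strict unfolding strict_theory_def by blast+

lemma de_en [simp]: "de (en v) = v"
  using inj_en by (rule inv_f_f)

lemma en_de: "p \<in> VV \<Longrightarrow> en (de p) = p"
  by (rule f_inv_into_f)

lemma en_eq_iff [simp]: "en u = en v \<longleftrightarrow> u = v"
  using inj_en by (simp add: inj_eq)

lemma small_T:
  assumes "small X"
  shows "small (T X)"
  using assms monad[unfolded set_monad_def, THEN conjunct1] by blast

lemma Tm_in:
  assumes "small X" "small Y" "f \<in> X \<rightarrow> Y" "t \<in> T X"
  shows "Tm X Y f t \<in> T Y"
  using assms monad[unfolded set_monad_def, THEN conjunct2, THEN conjunct1] by blast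

lemma Tm_cong:
  assumes "small X" "small Y" "f \<in> X \<rightarrow> Y" "\<And>x. x \<in> X \<Longrightarrow> f x = g x" "t \<in> T X"
  shows "Tm X Y f t = Tm X Y g t"
  using assms monad[unfolded set_monad_def, THEN conjunct2, THEN conjunct2, THEN conjunct1]
  by blast

lemma Tm_id:
  assumes "small X" "t \<in> T X"
  shows "Tm X X (\<lambda>x. x) t = t"
  using assms monad[unfolded set_monad_def, THEN conjunct2, THEN conjunct2, THEN conjunct2,
      THEN conjunct1]
  by blast

lemma Tm_comp:
  assumes "small X" "small Y" "small Z" "f \<in> X \<rightarrow> Y" "g \<in> Y \<rightarrow> Z" "t \<in> T X"
  shows "Tm Y Z g (Tm X Y f t) = Tm X Z (\<lambda>x. g (f x)) t"
  using assms monad[unfolded set_monad_def, THEN conjunct2, THEN conjunct2, THEN conjunct2,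
      THEN conjunct2, THEN conjunct1]
  by metis

lemma unit_in:
  assumes "small X" "x \<in> X"
  shows "e X x \<in> T X"
  using assms monad[unfolded set_monad_def, THEN conjunct2, THEN conjunct2, THEN conjunct2,
      THEN conjunct2, THEN conjunct2, THEN conjunct1]
  by blast

lemma Tm_unit:
  assumes "small X" "small Y" "f \<in> X \<rightarrow> Y" "x \<in> X"
  shows "Tm X Y f (e X x) = e Y (f x)"
  using assms monad[unfolded set_monad_def, THEN conjunct2, THEN conjunct2, THEN conjunct2,
      THEN conjunct2, THEN conjunct2, THEN conjunct2, THEN conjunct1]
  by blast

lemma Tm_mult:
  assumes "small X" "small Y" "f \<in> X \<rightarrow> Y" "tt \<in> T (T X)"
  shows "Tm X Y f (m X tt) = m Y (Tm (T X) (T Y) (Tm X Y f) tt)"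
  using assms monad[unfolded set_monad_def, THEN conjunct2, THEN conjunct2, THEN conjunct2,
      THEN conjunct2, THEN conjunct2, THEN conjunct2, THEN conjunct2, THEN conjunct2,
      THEN conjunct1]
  by blast

lemma mult_unit:
  assumes "small X" "t \<in> T X"
  shows "m X (e (T X) t) = t"
  using assms monad[unfolded set_monad_def, THEN conjunct2, THEN conjunct2, THEN conjunct2,
      THEN conjunct2, THEN conjunct2, THEN conjunct2, THEN conjunct2, THEN conjunct2,
      THEN conjunct2, THEN conjunct1]
  by blast

text \<open>This is where \<open>T 1 = 1\<close> enters: a constant map factors through a
  one-element set, and the single point of \<open>T\<close> there has to be the unit.\<close>

lemma Tm_const:
  assumes "small X" "small Y" "y \<in> Y" "t \<in> T X"
  shows "Tm X Y (\<lambda>_. y) t = e Y y"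
proof -
  have "Tm X {y} (\<lambda>_. y) t \<in> T {y}"
    using assms by (intro Tm_in) (auto simp: small_singleton)
  moreover have "e {y} y \<in> T {y}"
    by (intro unit_in) (auto simp: small_singleton)
  ultimately have *: "Tm X {y} (\<lambda>_. y) t = e {y} y"
    using T_one unfolding T_one_eq_one_def by (metis singletonD)
  have "Tm X Y (\<lambda>_. y) t = Tm {y} Y (\<lambda>z. z) (Tm X {y} (\<lambda>_. y) t)"
    using assms by (subst Tm_comp) (auto simp: small_singleton)
  also have "\<dots> = e Y y"
    unfolding * using assms by (intro Tm_unit) (auto simp: small_singleton)
  finally show ?thesis .
qed

text \<open>The set \<open>prd X I\<close> is the pullback of \<open>g\<close> along the projection
  \<open>pi2\<close> of \<open>prd X F\<close>, and \<open>T\<close> sends this square to a weak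
  pullback. It serves to replace test elements for the structure of \<open>Omega\<close> that lie
  over an image under \<open>Tm I F g\<close>.\<close>

lemma Tm_pullback_lift:
  assumes "small X" "small I" "small F" "g \<in> I \<rightarrow> F" "q \<in> T (prd X F)" "t \<in> T I"
    and eq: "Tm (prd X F) F pi2 q = Tm I F g t"
  obtains r where "r \<in> T (prd X I)"
    "Tm (prd X I) (prd X F) (\<lambda>p. pair (pi1 p) (g (pi2 p))) r = q" "Tm (prd X I) I pi2 r = t"
proof -
  have pb: "is_pullback (prd X I) (prd X F) I (\<lambda>p. pair (pi1 p) (g (pi2 p))) pi2 pi2 g"
    unfolding is_pullback_def
  proof (intro conjI ballI impI)
    fix p t assume "p \<in> prd X F" "t \<in> I" "pi2 p = g t"
    then show "\<exists>!w. w \<in> prd X I \<and> pair (pi1 w) (g (pi2 w)) = p \<and> pi2 w = t"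
      by (intro ex1I[of _ "pair (pi1 p) t"]) (auto elim!: prdE)
  qed (use assms(4) in \<open>auto elim!: prdE\<close>)
  have "is_weak_pullback (T (prd X I)) (T (prd X F)) (T I)
      (Tm (prd X I) (prd X F) (\<lambda>p. pair (pi1 p) (g (pi2 p)))) (Tm (prd X I) I pi2)
      (Tm (prd X F) F pi2) (Tm I F g)"
    by (rule bc[unfolded beck_chevalley_def, THEN conjunct1, rule_format])
      (use assms(1-4) pb pi2_in[of X F] in \<open>auto intro: small_prd\<close>)
  then show thesis
    using assms(5,6) eq that unfolding is_weak_pullback_def by blast
qed

section \<open>Laws of the extension \<open>\<xi>ext\<close>\<close>

lemma \<xi>ext_cong:
  assumes "small X" "\<And>x. x \<in> X \<Longrightarrow> \<phi> x = \<phi>' x" "t \<in> T X"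
  shows "\<xi>ext X \<phi> t = \<xi>ext X \<phi>' t"
  unfolding \<xi>ext_def using assms small_VV by (intro arg_cong[where f = \<xi>] Tm_cong) auto

lemma \<xi>ext_map:
  assumes "small X" "small Y" "f \<in> X \<rightarrow> Y" "t \<in> T X"
  shows "\<xi>ext Y \<phi> (Tm X Y f t) = \<xi>ext X (\<lambda>x. \<phi> (f x)) t"
  unfolding \<xi>ext_def using assms small_VV by (subst Tm_comp) auto

lemma \<xi>_unit: "\<xi> (e VV (en v)) = v"
proof -
  have "en (\<xi> (e VV (en v))) = en v"
    using alg_VV unfolding algebra_def by blast
  then show ?thesis by simp
qed

lemma \<xi>ext_unit:
  assumes "small X" "x \<in> X"
  shows "\<xi>ext X \<phi> (e X x) = \<phi> x"
  unfolding \<xi>ext_def using assms small_VV by (subst Tm_unit) (auto simp: \<xi>_unit)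

text \<open>\<open>T\<close> of a constant map is the unit at its value by \<open>Tm_const\<close>,
  and the unit law of the algebra \<open>\<xi>\<close> returns this value.\<close>

lemma \<xi>ext_const:
  assumes "small X" "t \<in> T X"
  shows "\<xi>ext X (\<lambda>_. v) t = v"
  unfolding \<xi>ext_def using assms small_VV by (subst Tm_const) (auto simp: \<xi>_unit)

lemma \<xi>ext_mono:
  assumes "small X" "\<And>x. x \<in> X \<Longrightarrow> \<phi> x \<le> \<phi>' x" "t \<in> T X"
  shows "\<xi>ext X \<phi> t \<le> \<xi>ext X \<phi>' t"
  using assms strict[unfolded strict_theory_def, THEN conjunct2, THEN conjunct2,
      THEN conjunct2, THEN conjunct2, THEN conjunct2, THEN conjunct2, THEN conjunct2,
      THEN conjunct1]
  by blast

lemma \<xi>ext_SUP_fibre: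
  assumes "small X" "small Y" "f \<in> X \<rightarrow> Y" "t \<in> T Y"
  shows "\<xi>ext Y (\<lambda>y. Sup {\<phi> x | x. x \<in> X \<and> f x = y}) t
    = Sup {\<xi>ext X \<phi> s | s. s \<in> T X \<and> Tm X Y f s = t}"
  using assms strict[unfolded strict_theory_def, THEN conjunct2, THEN conjunct2,
      THEN conjunct2, THEN conjunct2, THEN conjunct2, THEN conjunct2, THEN conjunct2,
      THEN conjunct2]
  by blast

text \<open>Both functions are packed into one map \<open>d\<close> to \<open>prd VV VV\<close>. The
  homomorphism property of the tensor then applies to the image of \<open>t\<close> under
  \<open>d\<close>, and the two projections recover the factors.\<close>

lemma \<xi>ext_times:
  assumes "small X" "t \<in> T X"
  shows "\<xi>ext X (\<lambda>x. \<phi> x * \<psi> x) t = \<xi>ext X \<phi> t * \<xi>ext X \<psi> t"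
proof -
  define d where "d x = pair (en (\<phi> x)) (en (\<psi> x))" for x
  have d: "d \<in> X \<rightarrow> prd VV VV"
    by (auto simp: d_def)
  note sm = small_prd[OF small_VV small_VV]
  have "Tm X (prd VV VV) d t \<in> T (prd VV VV)"
    using assms d sm by (intro Tm_in)
  then have "\<xi>ext (prd VV VV) (\<lambda>p. de (pi1 p) * de (pi2 p)) (Tm X (prd VV VV) d t) =
     \<xi> (Tm (prd VV VV) VV pi1 (Tm X (prd VV VV) d t)) * \<xi> (Tm (prd VV VV) VV pi2 (Tm X (prd VV VV) d t))"
    by (rule strict[unfolded strict_theory_def, THEN conjunct2, THEN conjunct2, THEN conjunct2,
          THEN conjunct2, THEN conjunct2, THEN conjunct1, rule_format])
  then show ?thesis
    using assms d sm small_VV by (simp add: \<xi>ext_map Tm_comp pi1_in pi2_in d_def \<xi>ext_def)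
qed

lemma \<xi>ext_times_const:
  assumes "small X" "t \<in> T X"
  shows "\<xi>ext X (\<lambda>x. v * \<phi> x) t = v * \<xi>ext X \<phi> t"
  using assms by (simp add: \<xi>ext_times \<xi>ext_const)

text \<open>Naturality of \<open>m\<close> moves the multiplication from \<open>X\<close> to
  \<open>VV\<close>, where the associativity law of the algebra \<open>\<xi>\<close>
  applies.\<close>

lemma \<xi>ext_mult:
  assumes "small X" "tt \<in> T (T X)"
  shows "\<xi>ext X \<phi> (m X tt) = \<xi>ext (T X) (\<xi>ext X \<phi>) tt"
proof -
  let ?f = "\<lambda>x. en (\<phi> x)"
  have f: "?f \<in> X \<rightarrow> VV" by auto
  have Tf: "Tm X VV ?f \<in> T X \<rightarrow> T VV"
    using assms f small_VV by (auto intro: Tm_in)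
  have tt: "Tm (T X) (T VV) (Tm X VV ?f) tt \<in> T (T VV)"
    using assms Tf small_VV by (intro Tm_in small_T)
  have "en (\<xi> (m VV (Tm (T X) (T VV) (Tm X VV ?f) tt)))
    = en (\<xi> (Tm (T VV) VV (\<lambda>t. en (\<xi> t)) (Tm (T X) (T VV) (Tm X VV ?f) tt)))"
    using alg_VV tt unfolding algebra_def by blast
  also have "\<dots> = en (\<xi>ext (T X) (\<xi>ext X \<phi>) tt)"
    unfolding \<xi>ext_def using assms Tf small_VV by (subst Tm_comp) (auto intro: small_T)
  finally show ?thesis
    using assms f small_VV by (simp add: \<xi>ext_def[of X] Tm_mult)
qed


section \<open>Frames given by pointwise evaluation\<close>

lemma tmor_cong:
  assumes "tmor A B f" "small (carr A)" "small (carr B)" "\<And>x. x \<in> carr A \<Longrightarrow> f x = g x"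
  shows "tmor A B g"
proof -
  have "Tm (carr A) (carr B) f t = Tm (carr A) (carr B) g t" if "t \<in> T (carr A)" for t
    using assms that by (intro Tm_cong) (auto simp: tmor_def)
  then show ?thesis
    using assms unfolding tmor_def by (auto simp: Pi_iff)
qed

lemma tmor_comp:
  assumes "tmor A B f" "tmor B C g" "small (carr A)" "small (carr B)" "small (carr C)"
  shows "tmor A C (\<lambda>x. g (f x))"
  unfolding tmor_def
proof (intro conjI ballI)
  have f: "f \<in> carr A \<rightarrow> carr B" and g: "g \<in> carr B \<rightarrow> carr C"
    using assms by (auto simp: tmor_def)
  then show "(\<lambda>x. g (f x)) \<in> carr A \<rightarrow> carr C" by auto
  fix t x assume t: "t \<in> T (carr A)" and x: "x \<in> carr A"
  have t': "Tm (carr A) (carr B) f t \<in> T (carr B)"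
    using assms f t by (intro Tm_in)
  have "str A t x \<le> str B (Tm (carr A) (carr B) f t) (f x)"
    using assms(1) t x by (auto simp: tmor_def)
  also have "\<dots> \<le> str C (Tm (carr B) (carr C) g (Tm (carr A) (carr B) f t)) (g (f x))"
    using assms(2) t' f x by (auto simp: tmor_def)
  finally show "str A t x \<le> str C (Tm (carr A) (carr C) (\<lambda>x. g (f x)) t) (g (f x))"
    using assms f g t by (simp add: Tm_comp)
qed

lemma tmor_und:
  assumes "tmor A B f" "small (carr A)" "small (carr B)" "x \<in> carr A" "y \<in> carr A"
  shows "und A x y \<le> und B (f x) (f y)"
proof -
  have "str A (e (carr A) x) y \<le> str B (Tm (carr A) (carr B) f (e (carr A) x)) (f y)"
    using assms unit_in[of "carr A" x] unfolding tmor_def by blast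
  then show ?thesis
    using assms unfolding und_def tmor_def by (simp add: Tm_unit)
qed

end

text \<open>The common pattern of \<open>V\<close> and of the graphs \<open>Omega X\<close>:
  elements behave like \<open>V\<close>-valued functions on \<open>S\<close> through
  \<open>ev\<close>. The last three assumptions only assert that pointwise candidates exist. That
  limits, tensors and weighted colimits must agree with them is derived, and \<open>ev_ext\<close>
  makes isomorphic objects equal.\<close>

locale pointwise_graph = strict_topological_theory \<T>
  for \<T> :: "('u::set_universe, 'v::comm_quantale) theory_data" +
  fixes A :: "('u, 'v) tgraph" and S :: "'u set" and ev :: "'u \<Rightarrow> 'u \<Rightarrow> 'v"
  assumes small_carr: "small (carr A)"
    and und_eq: "a \<in> carr A \<Longrightarrow> b \<in> carr A \<Longrightarrow> und A a b = (INF s\<in>S. qhom (ev s a) (ev s b))"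
    and ev_ext: "a \<in> carr A \<Longrightarrow> b \<in> carr A \<Longrightarrow> (\<And>s. s \<in> S \<Longrightarrow> ev s a = ev s b) \<Longrightarrow> a = b"
    and ev_representable: "s \<in> S \<Longrightarrow> \<exists>\<rho>\<in>carr A. \<forall>a\<in>carr A. und A \<rho> a = ev s a"
    and pointwise_lim: "h \<in> I \<rightarrow> carr A \<Longrightarrow>
      \<exists>l\<in>carr A. \<forall>s\<in>S. ev s l = (INF i\<in>I. qhom (w i) (ev s (h (i :: 'u))))"
    and pointwise_tensor: "a \<in> carr A \<Longrightarrow> \<exists>t\<in>carr A. \<forall>s\<in>S. ev s t = v * ev s a"
    and pointwise_T_sup: "algebra I \<alpha> \<Longrightarrow> tmor (alg_graph I \<alpha>) A t \<Longrightarrow>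
      \<exists>c\<in>carr A. \<forall>s\<in>S. ev s c = (SUP i\<in>I. ev s (t i))"
begin

lemma le_und:
  "a \<in> carr A \<Longrightarrow> b \<in> carr A \<Longrightarrow> u \<le> und A a b \<longleftrightarrow> (\<forall>s\<in>S. u * ev s a \<le> ev s b)"
  by (simp add: und_eq le_INF_iff le_qhom)

lemma und_refl: "a \<in> carr A \<Longrightarrow> 1 \<le> und A a a"
  by (simp add: le_und)

lemma und_ev: "a \<in> carr A \<Longrightarrow> b \<in> carr A \<Longrightarrow> s \<in> S \<Longrightarrow> und A a b * ev s a \<le> ev s b"
  using le_und by blast

lemma und_trans:
  assumes "a \<in> carr A" "b \<in> carr A" "c \<in> carr A"
  shows "und A a b * und A b c \<le> und A a c"
proof -
  have "und A a b * und A b c * ev s a \<le> ev s c" if "s \<in> S" for s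
  proof -
    have "und A b c * (und A a b * ev s a) \<le> und A b c * ev s b"
      using assms that by (intro quantale_mult_mono und_ev) auto
    also have "\<dots> \<le> ev s c"
      using assms that by (intro und_ev)
    finally show ?thesis
      by (simp add: ac_simps)
  qed
  then show ?thesis
    using assms by (simp add: le_und)
qed

lemma vcat: "vcat (carr A) (und A)"
  unfolding vcat_def using und_refl und_trans by blast

lemma und_antisym:
  assumes "a \<in> carr A" "b \<in> carr A" "1 \<le> und A a b" "1 \<le> und A b a"
  shows "a = b"
  using assms by (intro ev_ext antisym) (auto simp: le_und)

lemma und_coyoneda:
  assumes "a \<in> carr A" "b \<in> carr A" "\<And>y. y \<in> carr A \<Longrightarrow> und A a y = und A b y"
  shows "a = b"
  using assms und_refl by (metis und_antisym)

text \<open>Evaluations are representable and homs out of an object preserve limits, so every limit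
  is pointwise. Conversely, the hom into a pointwise limit is an infimum of homs between values, and
  the two infima commute.\<close>

lemma is_lim_iff:
  assumes h: "h \<in> I \<rightarrow> carr A"
  shows "is_lim (carr A) (und A) I w h l \<longleftrightarrow>
    l \<in> carr A \<and> (\<forall>s\<in>S. ev s l = (INF i\<in>I. qhom (w i) (ev s (h i))))" (is "?L \<longleftrightarrow> ?R")
proof
  assume L: ?L
  then have "l \<in> carr A" by (simp add: is_lim_def)
  moreover have "ev s l = (INF i\<in>I. qhom (w i) (ev s (h i)))" if s: "s \<in> S" for s
  proof -
    obtain \<rho> where \<rho>: "\<rho> \<in> carr A" "\<And>a. a \<in> carr A \<Longrightarrow> und A \<rho> a = ev s a"
      using ev_representable[OF s] by blast
    have "ev s l = und A \<rho> l"
      using \<rho> \<open>l \<in> carr A\<close> by simp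
    also have "\<dots> = (INF i\<in>I. qhom (w i) (und A \<rho> (h i)))"
      using L \<rho>(1) unfolding is_lim_def by blast
    also have "\<dots> = (INF i\<in>I. qhom (w i) (ev s (h i)))"
      using h \<rho> by (intro INF_cong refl arg_cong[where f = "qhom _"]) auto
    finally show ?thesis .
  qed
  ultimately show ?R by blast
next
  assume R: ?R
  have "und A y l = (INF i\<in>I. qhom (w i) (und A y (h i)))" if y: "y \<in> carr A" for y
  proof (rule eq_if_same_lower_bounds)
    fix u
    have hi: "h i \<in> carr A" if "i \<in> I" for i using h that by auto
    have swap: "u * ev s y * w i = u * w i * ev s y" for s i
      by (simp add: ac_simps)
    show "u \<le> und A y l \<longleftrightarrow> u \<le> (INF i\<in>I. qhom (w i) (und A y (h i)))"
      using R y hi by (auto simp: le_und le_INF_iff le_qhom swap)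
  qed
  with R show ?L by (simp add: is_lim_def)
qed

text \<open>Homs out of \<open>\<rho>\<close> need not preserve tensors, so representability does
  not help here. Instead the pointwise tensor exists and has the universal property, and tensors are
  unique.\<close>

lemma is_tensor_iff:
  assumes a: "a \<in> carr A"
  shows "is_tensor (carr A) (und A) v a t \<longleftrightarrow> t \<in> carr A \<and> (\<forall>s\<in>S. ev s t = v * ev s a)"
    (is "_ \<longleftrightarrow> ?R t")
proof
  have *: "is_tensor (carr A) (und A) v a t" if R: "?R t" for t
  proof -
    have "und A t y = qhom v (und A a y)" if y: "y \<in> carr A" for y
      by (rule eq_if_same_lower_bounds) (use R y a in \<open>auto simp: le_und le_qhom mult.assoc\<close>)
    with R show ?thesis by (simp add: is_tensor_def)
  qed
  show "?R t \<Longrightarrow> is_tensor (carr A) (und A) v a t" by (rule *)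
  assume t: "is_tensor (carr A) (und A) v a t"
  obtain t' where t': "?R t'"
    using pointwise_tensor[OF a] by blast
  have "t = t'"
    using t *[OF t'] t' by (intro und_coyoneda) (auto simp: is_tensor_def)
  with t' show "?R t" by simp
qed

text \<open>The tensors of a weighted diagram form a graph morphism from an algebra, so
  \<open>pointwise_T_sup\<close> provides their pointwise supremum. It has the universal property of
  the colimit, and uniqueness carries the formula over to any colimit.\<close>

lemma is_colim_iff:
  assumes wd: "weighted_diagram A I \<alpha> d h \<psi>"
  shows "is_colim (carr A) (und A) I \<psi> h c \<longleftrightarrow>
    c \<in> carr A \<and> (\<forall>s\<in>S. ev s c = (SUP i\<in>I. \<psi> i * ev s (h i)))" (is "_ \<longleftrightarrow> ?R c")
proof
  have hi: "h i \<in> carr A" if "i \<in> I" for i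
    using wd that by (auto simp: weighted_diagram_def vfunctor_def)
  have *: "is_colim (carr A) (und A) I \<psi> h c" if R: "?R c" for c
  proof -
    have "und A c y = (INF i\<in>I. qhom (\<psi> i) (und A (h i) y))" if y: "y \<in> carr A" for y
    proof (rule eq_if_same_lower_bounds)
      fix u
      show "u \<le> und A c y \<longleftrightarrow> u \<le> (INF i\<in>I. qhom (\<psi> i) (und A (h i) y))"
        using R y hi by (auto simp: le_und le_INF_iff le_qhom mult_SUP SUP_le_iff mult.assoc)
    qed
    with R show ?thesis by (simp add: is_colim_def)
  qed
  show "?R c \<Longrightarrow> is_colim (carr A) (und A) I \<psi> h c" by (rule *)
  assume c: "is_colim (carr A) (und A) I \<psi> h c"
  obtain t where t: "\<And>i. i \<in> I \<Longrightarrow> is_tensor (carr A) (und A) (\<psi> i) (h i) (t i)"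
    and "algebra I \<alpha>" "tmor (alg_graph I \<alpha>) A t"
    using wd unfolding weighted_diagram_def by blast
  then obtain c' where c': "c' \<in> carr A" "\<And>s. s \<in> S \<Longrightarrow> ev s c' = (SUP i\<in>I. ev s (t i))"
    using pointwise_T_sup by meson
  have R': "?R c'"
    using c' t hi by (auto simp: is_tensor_iff intro!: SUP_cong)
  have "c = c'"
    using c *[OF R'] R' by (intro und_coyoneda) (auto simp: is_colim_def)
  with R' show "?R c" by simp
qed

text \<open>The supremum of \<open>p\<close> is the colimit of a diagram generating
  \<open>p\<close>, hence pointwise. As \<open>\<rho>\<close> represents evaluation at
  \<open>s\<close>, the resulting formula is the one for \<open>p\<close> at
  \<open>\<rho>\<close>.\<close>

lemma ev_sup_of_T_generated:
  assumes gen: "t_generated A p" and sup: "is_sup (carr A) (und A) p z"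
    and s: "s \<in> S" and \<rho>: "\<rho> \<in> carr A" "\<And>a. a \<in> carr A \<Longrightarrow> und A \<rho> a = ev s a"
  shows "ev s z = p \<rho>"
proof -
  obtain I \<alpha> d h \<psi> where wd: "weighted_diagram A I \<alpha> d h \<psi>"
    and p: "\<And>x. x \<in> carr A \<Longrightarrow> p x = (SUP i\<in>I. und A x (h i) * \<psi> i)"
    using gen unfolding t_generated_def by blast
  have hi: "h i \<in> carr A" if "i \<in> I" for i
    using wd that by (auto simp: weighted_diagram_def vfunctor_def)
  \<comment> \<open>Bounds at the generators \<open>h i\<close> give bounds at every
    \<open>x\<close> by composition. The converse takes \<open>x\<close> to be \<open>h i\<close>
    and uses reflexivity.\<close>
  have "(INF x\<in>carr A. qhom (p x) (und A x y)) = (INF i\<in>I. qhom (\<psi> i) (und A (h i) y))"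
    if y: "y \<in> carr A" for y
  proof (rule eq_if_same_lower_bounds)
    fix u
    have "u * (und A x (h i) * \<psi> i) \<le> und A x y"
      if "u * \<psi> i \<le> und A (h i) y" "x \<in> carr A" "i \<in> I" for x i
    proof -
      have "und A x (h i) * (u * \<psi> i) \<le> und A x (h i) * und A (h i) y"
        using that by (intro quantale_mult_mono) auto
      also have "\<dots> \<le> und A x y"
        using that hi y by (intro und_trans) auto
      finally show ?thesis by (simp add: ac_simps)
    qed
    moreover have "u * \<psi> i \<le> und A (h i) y"
      if "u * (und A (h i) (h i) * \<psi> i) \<le> und A (h i) y" "i \<in> I" for i
    proof -
      have "u * (1 * \<psi> i) \<le> u * (und A (h i) (h i) * \<psi> i)"
        using that hi by (intro quantale_mult_mono und_refl) auto
      then show ?thesis using that by auto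
    qed
    ultimately show "u \<le> (INF x\<in>carr A. qhom (p x) (und A x y)) \<longleftrightarrow>
        u \<le> (INF i\<in>I. qhom (\<psi> i) (und A (h i) y))"
      using hi by (auto simp: le_INF_iff le_qhom p mult_SUP SUP_le_iff)
  qed
  then have "is_colim (carr A) (und A) I \<psi> h z"
    using sup unfolding is_sup_def is_colim_def by simp
  then have "ev s z = (SUP i\<in>I. \<psi> i * ev s (h i))"
    using s by (simp add: is_colim_iff[OF wd])
  also have "\<dots> = p \<rho>"
    using \<rho> hi by (simp add: p mult.commute)
  finally show ?thesis .
qed

text \<open>The Yoneda lemma: one inequality evaluates at \<open>a\<close>, where the representable
  presheaf is at least \<open>1\<close>, and the other is the distributor law of
  \<open>q\<close>.\<close>

lemma psh_hom_yoneda: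
  assumes a: "a \<in> carr A" and q: "q \<in> psh (carr A) (und A)"
  shows "psh_hom (carr A) (\<lambda>x. und A x a) q = q a"
proof (rule eq_if_same_lower_bounds)
  fix u :: 'v
  have q': "und A x y * q y \<le> q x" if "x \<in> carr A" "y \<in> carr A" for x y
    using q that by (auto simp: psh_def dist_from_one_def)
  have "u \<le> q a" if "u * und A a a \<le> q a"
  proof -
    have "u * 1 \<le> u * und A a a"
      using a by (intro quantale_mult_mono und_refl) auto
    with that show ?thesis by auto
  qed
  moreover have "u * und A x a \<le> q x" if "u \<le> q a" "x \<in> carr A" for x
  proof -
    have "und A x a * u \<le> und A x a * q a"
      using that by (intro quantale_mult_mono) auto
    also have "\<dots> \<le> q x" using that a by (intro q')
    finally show ?thesis by (simp add: ac_simps)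
  qed
  ultimately show "u \<le> psh_hom (carr A) (\<lambda>x. und A x a) q \<longleftrightarrow> u \<le> q a"
    using a unfolding psh_hom_def by (auto simp: le_INF_iff le_qhom)
qed

text \<open>By the Yoneda lemma the value of a presheaf at \<open>a\<close> is a hom out of a
  representable presheaf, so the universal property of the limit, taken at this presheaf, gives its
  values.\<close>

lemma psh_lim_pointwise:
  assumes l: "is_lim (psh (carr A) (und A)) (psh_hom (carr A)) I w h l"
    and h: "h \<in> I \<rightarrow> psh (carr A) (und A)" and a: "a \<in> carr A"
  shows "l a = (INF i\<in>I. qhom (w i) (h i a))"
proof -
  have y: "(\<lambda>x. und A x a) \<in> psh (carr A) (und A)"
    using a und_trans by (auto simp: psh_def dist_from_one_def)
  have "l a = psh_hom (carr A) (\<lambda>x. und A x a) l"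
    using l a by (simp add: psh_hom_yoneda is_lim_def)
  also have "\<dots> = (INF i\<in>I. qhom (w i) (psh_hom (carr A) (\<lambda>x. und A x a) (h i)))"
    using l y unfolding is_lim_def by blast
  also have "\<dots> = (INF i\<in>I. qhom (w i) (h i a))"
    using h a by (intro INF_cong refl arg_cong[where f = "qhom _"] psh_hom_yoneda) auto
  finally show ?thesis .
qed

lemma tframe: "tframe A"
  unfolding tframe_def
proof (intro conjI allI impI)
  show "tgraph A"
    using small_carr und_refl by (auto simp: tgraph_def und_def)
  show "complete_vcat (carr A) (und A)"
    unfolding complete_vcat_def
  proof (intro conjI allI impI vcat)
    fix I :: "'u set" and d w h
    assume "small I \<and> Defs.vcat I d \<and> dist_to_one I d w \<and> vfunctor I d (carr A) (und A) h"
    then have "h \<in> I \<rightarrow> carr A" by (auto simp: vfunctor_def)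
    then show "\<exists>l. is_lim (carr A) (und A) I w h l"
      using pointwise_lim[of h I w] by (auto simp: is_lim_iff)
  qed
next
  fix I :: "'u set" and d w h l s \<sigma> r
  assume *: "small I \<and> Defs.vcat I d \<and> dist_to_one I d w \<and>
        vfunctor I d (psh (carr A) (und A)) (psh_hom (carr A)) h \<and>
        (\<forall>i\<in>I. t_generated A (h i)) \<and>
        is_lim (psh (carr A) (und A)) (psh_hom (carr A)) I w h l \<and> t_generated A l \<and>
        is_sup (carr A) (und A) l s \<and>
        (\<forall>i\<in>I. is_sup (carr A) (und A) (h i) (\<sigma> i)) \<and>
        is_lim (carr A) (und A) I w \<sigma> r"
  have h: "h \<in> I \<rightarrow> psh (carr A) (und A)"
    using * by (auto simp: vfunctor_def)
  have \<sigma>: "\<sigma> \<in> I \<rightarrow> carr A" and s: "s \<in> carr A"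
    using * by (auto simp: is_sup_def)
  have r: "r \<in> carr A" "\<And>x. x \<in> S \<Longrightarrow> ev x r = (INF i\<in>I. qhom (w i) (ev x (\<sigma> i)))"
    using * \<sigma> by (auto simp: is_lim_iff)
  \<comment> \<open>At the object \<open>\<rho>\<close> representing evaluation at \<open>x\<close>,
    suprema become values of presheaves. Commutation of suprema with the limit is then the pointwise
    formula for limits of presheaves.\<close>
  have "ev x s = ev x r" if x: "x \<in> S" for x
  proof -
    obtain \<rho> where \<rho>: "\<rho> \<in> carr A" "\<And>a. a \<in> carr A \<Longrightarrow> und A \<rho> a = ev x a"
      using ev_representable[OF x] by blast
    have "ev x s = l \<rho>"
      using * x \<rho> by (intro ev_sup_of_T_generated) auto
    also have "\<dots> = (INF i\<in>I. qhom (w i) (h i \<rho>))"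
      using * h \<rho> by (intro psh_lim_pointwise) auto
    also have "\<dots> = (INF i\<in>I. qhom (w i) (ev x (\<sigma> i)))"
      using * x \<rho> ev_sup_of_T_generated[of "h i" "\<sigma> i" x \<rho> for i] by (intro INF_cong) auto
    also have "\<dots> = ev x r" using r x by simp
    finally show ?thesis .
  qed
  then have "s = r" using s r by (intro ev_ext) auto
  then show "viso (und A) s r"
    using s und_refl by (simp add: viso_def)
qed

end

section \<open>Frame homomorphisms and their composites\<close>

context strict_topological_theory
begin

text \<open>Here \<open>\<tau>\<close> exhibits \<open>f\<close> as precomposition on the level of evaluations.\<close>

lemma
  assumes pA: "pointwise_graph \<T> A S evA" and pB: "pointwise_graph \<T> B S' evB"
    and f: "tmor A B f" and \<tau>: "\<tau> \<in> S' \<rightarrow> S"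
    and ev: "\<And>s a. s \<in> S' \<Longrightarrow> a \<in> carr A \<Longrightarrow> evB s (f a) = evA (\<tau> s) a"
  shows weighted_diagram_map:
      "weighted_diagram A I \<alpha> d h \<psi> \<Longrightarrow> weighted_diagram B I \<alpha> d (\<lambda>i. f (h i)) \<psi>"
    and frame_hom_pointwise: "frame_hom A B f"
proof -
  interpret A: pointwise_graph \<T> A S evA by (rule pA)
  interpret B: pointwise_graph \<T> B S' evB by (rule pB)
  have fA: "f a \<in> carr B" if "a \<in> carr A" for a
    using f that by (auto simp: tmor_def)
  have vf: "vfunctor (carr A) (und A) (carr B) (und B) f"
    using fA tmor_und[OF f A.small_carr B.small_carr] by (auto simp: vfunctor_def)
  have compat: "compatible A B f"
    unfolding compatible_def
    using tmor_comp[OF _ f _ A.small_carr B.small_carr] by (auto simp: alg_graph_def algebra_def)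
  show wd: "weighted_diagram B I \<alpha> d (\<lambda>i. f (h i)) \<psi>" if "weighted_diagram A I \<alpha> d h \<psi>"
    for I \<alpha> d h \<psi>
  proof -
    obtain t where t: "\<And>i. i \<in> I \<Longrightarrow> is_tensor (carr A) (und A) (\<psi> i) (h i) (t i)"
      and alg: "algebra I \<alpha>" "tmor (alg_graph I \<alpha>) A t"
      and h: "vfunctor I d (carr A) (und A) h"
      using \<open>weighted_diagram A I \<alpha> d h \<psi>\<close> unfolding weighted_diagram_def by blast
    have hi: "h i \<in> carr A" if "i \<in> I" for i
      using h that by (auto simp: vfunctor_def)
    \<comment> \<open>Tensors are pointwise on both sides, so preserving values along
      \<open>\<tau>\<close> suffices to preserve them.\<close>
    have "is_tensor (carr B) (und B) (\<psi> i) (f (h i)) (f (t i))" if "i \<in> I" for i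
      using t[OF that] hi[OF that] fA ev \<tau> by (auto simp: A.is_tensor_iff B.is_tensor_iff)
    moreover have "tmor (alg_graph I \<alpha>) B (\<lambda>i. f (t i))"
      using compat alg by (auto simp: compatible_def)
    ultimately show ?thesis
      using \<open>weighted_diagram A I \<alpha> d h \<psi>\<close> vfunctor_comp[OF h vf] unfolding weighted_diagram_def
      by (intro conjI exI[of _ "\<lambda>i. f (t i)"]) auto
  qed
  show "frame_hom A B f"
    unfolding frame_hom_def
  proof (intro conjI allI impI A.tframe B.tframe vf compat)
    fix I :: "'u set" and d w h l
    assume *: "small I \<and> vcat I d \<and> dist_to_one I d w \<and> vfunctor I d (carr A) (und A) h \<and>
        is_lim (carr A) (und A) I w h l"
    then have h: "h \<in> I \<rightarrow> carr A" by (auto simp: vfunctor_def)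
    then have fh: "(\<lambda>i. f (h i)) \<in> I \<rightarrow> carr B" using fA by auto
    show "is_lim (carr B) (und B) I w (\<lambda>i. f (h i)) (f l)"
      unfolding B.is_lim_iff[OF fh]
      using * h fA \<tau> by (auto simp: A.is_lim_iff ev Pi_iff intro!: INF_cong)
  next
    fix I \<alpha> d h \<psi> c
    assume *: "weighted_diagram A I \<alpha> d h \<psi> \<and> is_colim (carr A) (und A) I \<psi> h c"
    then have h: "h \<in> I \<rightarrow> carr A" by (auto simp: weighted_diagram_def vfunctor_def)
    have wd': "weighted_diagram A I \<alpha> d h \<psi>" using * by blast
    show "is_colim (carr B) (und B) I \<psi> (\<lambda>i. f (h i)) (f c)"
      unfolding B.is_colim_iff[OF wd[OF wd']]
      using * h fA \<tau> by (auto simp: A.is_colim_iff[OF wd'] ev Pi_iff intro!: SUP_cong)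
  qed
qed

lemma frame_hom_lim:
  fixes I :: "'u set"
  assumes "frame_hom A B f" "small I" "vcat I d" "dist_to_one I d w"
    "vfunctor I d (carr A) (und A) h" "is_lim (carr A) (und A) I w h l"
  shows "is_lim (carr B) (und B) I w (\<lambda>i. f (h i)) (f l)"
  by (rule assms(1)[unfolded frame_hom_def, THEN conjunct2, THEN conjunct2, THEN conjunct2,
        THEN conjunct2, THEN conjunct1, rule_format]) (use assms in blast)

lemma frame_hom_colim:
  assumes "frame_hom A B f" "weighted_diagram A I \<alpha> d h \<psi>" "is_colim (carr A) (und A) I \<psi> h c"
  shows "is_colim (carr B) (und B) I \<psi> (\<lambda>i. f (h i)) (f c)"
  by (rule assms(1)[unfolded frame_hom_def, THEN conjunct2, THEN conjunct2, THEN conjunct2,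
        THEN conjunct2, THEN conjunct2, rule_format]) (use assms in blast)

text \<open>Points are stored as graphs with \<open>fn\<close>, and applying such a graph recovers
  the original map on the carrier only.\<close>

lemma frame_hom_cong:
  assumes fh: "frame_hom A B f" and eq: "\<And>x. x \<in> carr A \<Longrightarrow> f x = g x"
  shows "frame_hom A B g"
proof -
  have sm: "small (carr A)" "small (carr B)"
    using fh by (auto simp: frame_hom_def tframe_def tgraph_def)
  have lim_cong: "is_lim (carr B) (und B) I w (\<lambda>i. g (h i)) l"
    if "is_lim (carr B) (und B) I w (\<lambda>i. f (h i)) l" "h \<in> I \<rightarrow> carr A"
    for I w h and l :: 'u
    using that eq by (auto simp: is_lim_def Pi_iff cong: INF_cong)
  have colim_cong: "is_colim (carr B) (und B) I w (\<lambda>i. g (h i)) l"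
    if "is_colim (carr B) (und B) I w (\<lambda>i. f (h i)) l" "h \<in> I \<rightarrow> carr A"
    for I w h and l :: 'u
    using that eq by (auto simp: is_colim_def Pi_iff cong: INF_cong)
  show ?thesis
    unfolding frame_hom_def
  proof (intro conjI allI impI)
    show "tframe A" "tframe B"
      using fh by (auto simp: frame_hom_def)
    show "vfunctor (carr A) (und A) (carr B) (und B) g"
      using fh eq by (auto simp: frame_hom_def vfunctor_def Pi_iff)
    show "compatible A B g"
      unfolding compatible_def
    proof (intro allI impI)
      fix I \<alpha> h assume *: "algebra I \<alpha> \<and> tmor (alg_graph I \<alpha>) A h"
      then have "tmor (alg_graph I \<alpha>) B (\<lambda>i. f (h i))"
        using fh by (auto simp: frame_hom_def compatible_def)
      then show "tmor (alg_graph I \<alpha>) B (\<lambda>i. g (h i))"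
        by (rule tmor_cong) (use * sm eq in \<open>auto simp: algebra_def alg_graph_def tmor_def Pi_iff\<close>)
    qed
  next
    fix I :: "'u set" and d w h l
    assume *: "small I \<and> vcat I d \<and> dist_to_one I d w \<and> vfunctor I d (carr A) (und A) h \<and>
        is_lim (carr A) (und A) I w h l"
    then have "is_lim (carr B) (und B) I w (\<lambda>i. f (h i)) (f l)"
      using frame_hom_lim[OF fh, of I d w h l] by simp
    moreover have "h \<in> I \<rightarrow> carr A" "l \<in> carr A"
      using * by (auto simp: vfunctor_def is_lim_def)
    ultimately show "is_lim (carr B) (und B) I w (\<lambda>i. g (h i)) (g l)"
      using lim_cong[of I w h "f l"] eq[of l] by simp
  next
    fix I \<alpha> d h \<psi> c
    assume *: "weighted_diagram A I \<alpha> d h \<psi> \<and> is_colim (carr A) (und A) I \<psi> h c"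
    then have "is_colim (carr B) (und B) I \<psi> (\<lambda>i. f (h i)) (f c)"
      using frame_hom_colim[OF fh, of I \<alpha> d h \<psi> c] by simp
    moreover have "h \<in> I \<rightarrow> carr A" "c \<in> carr A"
      using * by (auto simp: weighted_diagram_def vfunctor_def is_colim_def)
    ultimately show "is_colim (carr B) (und B) I \<psi> (\<lambda>i. g (h i)) (g c)"
      using colim_cong[of I \<psi> h "f c"] eq[of c] by simp
  qed
qed

text \<open>Preservation of weighted colimits by the composite requires that \<open>f\<close>
  carries weighted diagrams in \<open>A\<close> to weighted diagrams in \<open>B\<close>. The
  pointwise description of tensors in both graphs provides this, while nothing of the kind is asked
  of \<open>C\<close>.\<close>

lemma frame_hom_comp_pointwise:
  assumes pA: "pointwise_graph \<T> A S evA" and pB: "pointwise_graph \<T> B S' evB"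
    and f: "tmor A B f" and \<tau>: "\<tau> \<in> S' \<rightarrow> S"
    and ev: "\<And>s a. s \<in> S' \<Longrightarrow> a \<in> carr A \<Longrightarrow> evB s (f a) = evA (\<tau> s) a"
    and g: "frame_hom B C g"
  shows "frame_hom A C (\<lambda>x. g (f x))"
proof -
  have fh: "frame_hom A B f"
    and wd: "\<And>I \<alpha> d h \<psi>. weighted_diagram A I \<alpha> d h \<psi> \<Longrightarrow> weighted_diagram B I \<alpha> d (\<lambda>i. f (h i)) \<psi>"
    by (rule frame_hom_pointwise[OF pA pB f \<tau> ev], assumption+)
      (rule weighted_diagram_map[OF pA pB f \<tau> ev], assumption+)
  have vf: "vfunctor (carr A) (und A) (carr B) (und B) f"
    using fh by (simp add: frame_hom_def)
  show ?thesis
    unfolding frame_hom_def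
  proof (intro conjI allI impI)
    show "tframe A"
      using fh by (simp add: frame_hom_def)
    show "tframe C"
      using g by (simp add: frame_hom_def)
    have "vfunctor (carr B) (und B) (carr C) (und C) g"
      using g by (simp add: frame_hom_def)
    with vf show "vfunctor (carr A) (und A) (carr C) (und C) (\<lambda>x. g (f x))"
      by (rule vfunctor_comp)
    have "compatible A B f"
      using fh by (simp add: frame_hom_def)
    moreover have "compatible B C g"
      using g by (simp add: frame_hom_def)
    ultimately show "compatible A C (\<lambda>x. g (f x))"
      unfolding compatible_def by simp
  next
    fix I :: "'u set" and d w h l
    assume *: "small I \<and> vcat I d \<and> dist_to_one I d w \<and> vfunctor I d (carr A) (und A) h \<and>
        is_lim (carr A) (und A) I w h l"
    then have "is_lim (carr B) (und B) I w (\<lambda>i. f (h i)) (f l)"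
      using frame_hom_lim[OF fh, of I d w h l] by simp
    moreover have "vfunctor I d (carr B) (und B) (\<lambda>i. f (h i))"
      using * vfunctor_comp[OF _ vf, of I d h] by simp
    ultimately show "is_lim (carr C) (und C) I w (\<lambda>i. g (f (h i))) (g (f l))"
      using frame_hom_lim[OF g, of I d w "\<lambda>i. f (h i)" "f l"] * by simp
  next
    fix I \<alpha> d h \<psi> c
    assume *: "weighted_diagram A I \<alpha> d h \<psi> \<and> is_colim (carr A) (und A) I \<psi> h c"
    then have "is_colim (carr B) (und B) I \<psi> (\<lambda>i. f (h i)) (f c)"
      using frame_hom_colim[OF fh, of I \<alpha> d h \<psi> c] by simp
    then show "is_colim (carr C) (und C) I \<psi> (\<lambda>i. g (f (h i))) (g (f c))"
      using frame_hom_colim[OF g wd, of I \<alpha> d h \<psi> "f c"] * by simp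
  qed
qed


section \<open>The quantale as a frame\<close>

lemma und_Vobj: "p \<in> VV \<Longrightarrow> und Vobj p q = qhom (de p) (de q)"
  using \<xi>_unit[of "de p"] by (simp add: und_def Vobj_def en_de)

text \<open>The case of a single evaluation, namely decoding, represented by the unit
  \<open>en 1\<close>. Its index \<open>z\<close> is left arbitrary so that it can later be a point
  of a given category.\<close>

lemma pointwise_Vobj: "pointwise_graph \<T> Vobj {z} (\<lambda>_. de)"
proof unfold_locales
  have carr: "carr Vobj = VV"
    by (simp add: Vobj_def)
  show "small (carr Vobj)"
    using small_VV by (simp add: carr)
  show "und Vobj a b = (INF s\<in>{z}. qhom (de a) (de b))" if "a \<in> carr Vobj" "b \<in> carr Vobj" for a b
    using that by (simp add: carr und_Vobj)
  show "a = b" if "a \<in> carr Vobj" "b \<in> carr Vobj" "\<And>s. s \<in> {z} \<Longrightarrow> de a = de b" for a b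
    using that unfolding carr by (metis en_de singletonI)
  show "\<exists>\<rho>\<in>carr Vobj. \<forall>a\<in>carr Vobj. und Vobj \<rho> a = de a" if "s \<in> {z}" for s
    by (rule bexI[of _ "en 1"]) (simp_all add: carr und_Vobj)
  show "\<exists>l\<in>carr Vobj. \<forall>s\<in>{z}. de l = (INF i\<in>I. qhom (w i) (de (h i)))" for h I w
    by (rule bexI[of _ "en (INF i\<in>I. qhom (w i) (de (h i)))"]) (simp_all add: carr)
  show "\<exists>t\<in>carr Vobj. \<forall>s\<in>{z}. de t = v * de a" for v a
    by (rule bexI[of _ "en (v * de a)"]) (simp_all add: carr)
  show "\<exists>c\<in>carr Vobj. \<forall>s\<in>{z}. de c = (SUP i\<in>I. de (t i))" for I t
    by (rule bexI[of _ "en (SUP i\<in>I. de (t i))"]) (simp_all add: carr)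
qed


section \<open>The frame of \<open>V\<close>-valued functors\<close>

abbreviation val :: "'u \<Rightarrow> 'u \<Rightarrow> 'v" where
  "val \<phi> x \<equiv> de (app \<phi> x)"

text \<open>The condition for a functor into \<open>Vobj\<close>, transposed along the adjunction of
  \<open>qhom\<close> and freed from the encoding of \<open>V\<close> in the universe.\<close>

definition T_valued :: "('u, 'v) tgraph \<Rightarrow> ('u \<Rightarrow> 'v) \<Rightarrow> bool" where
  "T_valued X g \<longleftrightarrow>
     (\<forall>t\<in>T (carr X). \<forall>x\<in>carr X. str X t x * \<xi>ext (carr X) g t \<le> g x)"

lemma T_valuedD:
  "T_valued X g \<Longrightarrow> t \<in> T (carr X) \<Longrightarrow> x \<in> carr X \<Longrightarrow> str X t x * \<xi>ext (carr X) g t \<le> g x"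
  by (simp add: T_valued_def)

lemma T_valued_cong:
  assumes "small (carr X)" "\<And>x. x \<in> carr X \<Longrightarrow> g x = g' x"
  shows "T_valued X g \<longleftrightarrow> T_valued X g'"
  unfolding T_valued_def using assms \<xi>ext_cong[of "carr X" g g'] by auto

lemma \<xi>ext_de:
  assumes "small X" "f \<in> X \<rightarrow> VV" "t \<in> T X"
  shows "\<xi>ext X (\<lambda>x. de (f x)) t = \<xi> (Tm X VV f t)"
  unfolding \<xi>ext_def using assms small_VV
  by (intro arg_cong[where f = \<xi>] Tm_cong) (auto intro!: en_de)

lemma tmor_Vobj_iff:
  assumes "small (carr X)"
  shows "tmor X Vobj f \<longleftrightarrow> f \<in> carr X \<rightarrow> VV \<and> T_valued X (\<lambda>x. de (f x))"
  using \<xi>ext_de[OF assms, of f] by (auto simp: tmor_def Vobj_def T_valued_def le_qhom)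

text \<open>For each \<open>i\<close>, multiplying the infimum by \<open>w i\<close> gives a
  function below \<open>h i\<close>. The extension \<open>\<xi>ext\<close> is monotone and commutes
  with multiplication by the constant \<open>w i\<close>, so the condition for \<open>h i\<close>
  applies.\<close>

lemma T_valued_lim:
  assumes "small (carr X)" "\<And>i. i \<in> I \<Longrightarrow> T_valued X (h i)"
  shows "T_valued X (\<lambda>x. INF i\<in>I. qhom (w i) (h i x))" (is "T_valued X ?l")
  unfolding T_valued_def
proof (intro ballI INF_greatest)
  fix t x i assume t: "t \<in> T (carr X)" and x: "x \<in> carr X" and i: "i \<in> I"
  have "?l y \<le> qhom (w i) (h i y)" for y
    using i by (rule INF_lower)
  then have "w i * ?l y \<le> h i y" for y
    by (simp add: le_qhom[symmetric] mult.commute[of "w i"])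
  then have "w i * \<xi>ext (carr X) ?l t \<le> \<xi>ext (carr X) (h i) t"
    using assms t by (subst \<xi>ext_times_const[symmetric]) (auto intro: \<xi>ext_mono)
  then have "str X t x * (w i * \<xi>ext (carr X) ?l t) \<le> str X t x * \<xi>ext (carr X) (h i) t"
    by (intro quantale_mult_mono) auto
  also have "\<dots> \<le> h i x"
    using assms i t x by (intro T_valuedD)
  finally show "str X t x * \<xi>ext (carr X) ?l t \<le> qhom (w i) (h i x)"
    by (simp add: le_qhom ac_simps)
qed

lemma T_valued_tensor:
  assumes "small (carr X)" "T_valued X g"
  shows "T_valued X (\<lambda>x. v * g x)"
  unfolding T_valued_def
proof (intro ballI)
  fix t x assume "t \<in> T (carr X)" "x \<in> carr X"
  then have "v * (str X t x * \<xi>ext (carr X) g t) \<le> v * g x"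
    using assms by (intro quantale_mult_mono T_valuedD) auto
  then show "str X t x * \<xi>ext (carr X) (\<lambda>x. v * g x) t \<le> v * g x"
    using assms \<open>t \<in> T (carr X)\<close> by (simp add: \<xi>ext_times_const ac_simps)
qed

text \<open>This is the composition law of \<open>X\<close> with the unit of \<open>e x\<close> in
  \<open>T (T X)\<close> as its first argument; the unit law of the monad collapses \<open>m\<close>
  of it to \<open>e x\<close>.\<close>

lemma T_valued_representable:
  assumes "tcat X" "x \<in> carr X"
  shows "T_valued X (\<lambda>y. str X (e (carr X) x) y)" (is "T_valued X ?r")
  unfolding T_valued_def
proof (intro ballI)
  let ?X = "carr X"
  have X: "small ?X"
    using assms by (simp add: tcat_def tgraph_def)
  have ex: "e ?X x \<in> T ?X"
    using X assms by (intro unit_in)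
  fix t y assume t: "t \<in> T ?X" and y: "y \<in> ?X"
  \<comment> \<open>This \<open>w\<close> witnesses the supremum in \<open>Txi\<close>: its second
    projection is \<open>t\<close>, and its first is the image under a constant map, hence a unit by
    \<open>Tm_const\<close>.\<close>
  define w where "w = Tm ?X (prd (T ?X) ?X) (\<lambda>z. pair (e ?X x) z) t"
  have p: "(\<lambda>z. pair (e ?X x) z) \<in> ?X \<rightarrow> prd (T ?X) ?X"
    using ex by auto
  note sm = X small_T[OF X] small_prd[OF small_T[OF X] X]
  have w: "w \<in> T (prd (T ?X) ?X)"
    unfolding w_def using sm p t by (intro Tm_in)
  have w1: "Tm (prd (T ?X) ?X) (T ?X) pi1 w = e (T ?X) (e ?X x)"
    unfolding w_def using sm p t ex by (simp add: Tm_comp pi1_in Tm_const)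
  have w2: "Tm (prd (T ?X) ?X) ?X pi2 w = t"
    unfolding w_def using sm p t by (simp add: Tm_comp pi2_in Tm_id)
  have "\<xi>ext ?X ?r t = \<xi>ext (prd (T ?X) ?X) (\<lambda>p. str X (pi1 p) (pi2 p)) w"
    unfolding w_def using sm p t by (simp add: \<xi>ext_map)
  also have "\<dots> \<le> Txi (T ?X) ?X (str X) (e (T ?X) (e ?X x)) t"
    unfolding Txi_def using w w1 w2 by (intro Sup_upper) blast
  finally have "str X t y * \<xi>ext ?X ?r t \<le> Txi (T ?X) ?X (str X) (e (T ?X) (e ?X x)) t * str X t y"
    by (subst mult.commute) (intro quantale_mult_mono order_refl)
  also have "\<dots> \<le> str X (m ?X (e (T ?X) (e ?X x))) y"
    using assms(1) t y unit_in[OF sm(2) ex] unfolding tcat_def by blast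
  also have "\<dots> = str X (e ?X x) y"
    using X ex by (simp add: mult_unit)
  finally show "str X t y * \<xi>ext ?X ?r t \<le> str X (e ?X x) y" .
qed

lemma T_valued_unit:
  assumes "small (carr X)" "T_valued X g" "x \<in> carr X" "y \<in> carr X"
  shows "str X (e (carr X) x) y * g x \<le> g y"
  using T_valuedD[OF assms(2) unit_in[OF assms(1,3)] assms(4)] assms by (simp add: \<xi>ext_unit)

section \<open>Elements and graph structure of \<open>Omega X\<close>\<close>

lemma carr_Omega:
  assumes "small (carr X)"
  shows "carr (Omega X) = {fn (carr X) (\<lambda>x. en (g x)) | g. T_valued X g}"
proof -
  have "\<exists>g. fn (carr X) f = fn (carr X) (\<lambda>x. en (g x)) \<and> T_valued X g" if "tmor X Vobj f" for f
    using that assms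
    by (intro exI[of _ "\<lambda>x. de (f x)"]) (auto simp: tmor_Vobj_iff en_de Pi_iff intro!: fn_cong)
  moreover have "tmor X Vobj (\<lambda>x. en (g x))" if "T_valued X g" for g
    using that assms by (simp add: tmor_Vobj_iff)
  ultimately show ?thesis
    unfolding Omega_def Let_def by auto
qed

lemma Omega_memI: "small (carr X) \<Longrightarrow> T_valued X g \<Longrightarrow> fn (carr X) (\<lambda>x. en (g x)) \<in> carr (Omega X)"
  by (auto simp: carr_Omega)

lemma val_fn: "small X \<Longrightarrow> x \<in> X \<Longrightarrow> val (fn X (\<lambda>x. en (g x))) x = g x"
  by (simp add: app_fn)

lemma Omega_memD:
  assumes "small (carr X)" "\<phi> \<in> carr (Omega X)"
  shows "T_valued X (val \<phi>)" and "\<phi> = fn (carr X) (app \<phi>)"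
    and "x \<in> carr X \<Longrightarrow> app \<phi> x \<in> VV"
proof -
  obtain g where g: "\<phi> = fn (carr X) (\<lambda>x. en (g x))" "T_valued X g"
    using assms by (auto simp: carr_Omega)
  have app: "app \<phi> x = en (g x)" if "x \<in> carr X" for x
    using g that assms by (simp add: app_fn)
  show "T_valued X (val \<phi>)"
    using g(2) assms app T_valued_cong[of X "val \<phi>" g] by simp
  show "\<phi> = fn (carr X) (app \<phi>)"
    using app g(1) fn_cong[of "carr X" "app \<phi>" "\<lambda>x. en (g x)"] by simp
  show "x \<in> carr X \<Longrightarrow> app \<phi> x \<in> VV"
    using app by simp
qed

lemma small_carr_Omega:
  assumes "small (carr X)"
  shows "small (carr (Omega X))"
proof -
  have "carr (Omega X) \<subseteq> {fn (carr X) f | f. f \<in> carr X \<rightarrow> VV}"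
    using assms by (auto simp: carr_Omega)
  then show ?thesis
    using small_fn_space[OF assms small_VV] small_subset by blast
qed

text \<open>Transposing both occurrences of \<open>qhom\<close> leaves inequalities between
  products, tested by the elements \<open>q\<close> over \<open>pp\<close>; all later arguments
  about this structure use that form.\<close>

lemma le_str_Omega:
  assumes "small (carr X)"
  shows "u \<le> str (Omega X) pp \<phi> \<longleftrightarrow>
    (\<forall>x\<in>carr X. \<forall>q\<in>T (prd (carr X) (carr (Omega X))).
       Tm (prd (carr X) (carr (Omega X))) (carr (Omega X)) pi2 q = pp \<longrightarrow>
       u * str X (Tm (prd (carr X) (carr (Omega X))) (carr X) pi1 q) x *
         \<xi>ext (prd (carr X) (carr (Omega X))) (\<lambda>p. val (pi2 p) (pi1 p)) q \<le> val \<phi> x)"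
proof -
  let ?P = "prd (carr X) (carr (Omega X))"
  have ev: "(\<lambda>p. app (pi2 p) (pi1 p)) \<in> ?P \<rightarrow> VV"
    using Omega_memD(3)[OF assms] by (auto elim!: prdE)
  have P: "small ?P"
    using assms by (intro small_prd small_carr_Omega)
  have F: "{fn (carr X) \<phi> |\<phi>. tmor X Vobj \<phi>} = carr (Omega X)"
    by (simp add: Omega_def Let_def)
  have str: "str (Omega X) pp \<phi> = Inf {qhom (str X (Tm ?P (carr X) pi1 q) x)
        (qhom (\<xi> (Tm ?P VV (\<lambda>p. app (pi2 p) (pi1 p)) q)) (val \<phi> x))
      | x q. x \<in> carr X \<and> q \<in> T ?P \<and> Tm ?P (carr (Omega X)) pi2 q = pp}"
    unfolding F[symmetric] by (simp add: Omega_def Let_def)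
  have le_Inf: "u \<le> Inf {G x q | x q. x \<in> carr X \<and> q \<in> T ?P \<and> Q q} \<longleftrightarrow>
      (\<forall>x\<in>carr X. \<forall>q\<in>T ?P. Q q \<longrightarrow> u \<le> G x q)" for G :: "'u \<Rightarrow> 'u \<Rightarrow> 'v" and Q
    unfolding le_Inf_iff by blast
  show ?thesis
    unfolding str le_Inf using \<xi>ext_de[OF P ev] by (simp add: le_qhom)
qed

lemma str_OmegaD:
  assumes "small (carr X)" "x \<in> carr X" "q \<in> T (prd (carr X) (carr (Omega X)))"
  shows "str (Omega X) (Tm (prd (carr X) (carr (Omega X))) (carr (Omega X)) pi2 q) \<phi> *
       str X (Tm (prd (carr X) (carr (Omega X))) (carr X) pi1 q) x *
       \<xi>ext (prd (carr X) (carr (Omega X))) (\<lambda>p. val (pi2 p) (pi1 p)) q \<le> val \<phi> x"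
  by (rule le_str_Omega[THEN iffD1, OF assms(1) order_refl, rule_format, OF assms(2,3) refl])

text \<open>
  Over a principal point \<open>e \<phi>\<close> the elements of \<open>T (X \<times> \<Omega> X)\<close> come from \<open>T X\<close>, because \<open>T\<close> sends the
  pullback of \<open>\<phi>\<close> along the projection to a weak pullback.
\<close>

lemma und_Omega:
  assumes X: "tgraph X" and a: "a \<in> carr (Omega X)" and b: "b \<in> carr (Omega X)"
  shows "und (Omega X) a b = (INF x\<in>carr X. qhom (val a x) (val b x))"
proof (rule eq_if_same_lower_bounds)
  let ?X = "carr X" and ?F = "carr (Omega X)"
  let ?P = "prd ?X ?F"
  fix u
  have sm: "small ?X" "small ?F" "small ?P"
    using X by (auto simp: tgraph_def intro: small_prd small_carr_Omega)
  have "u * val a x \<le> val b x" if u: "u \<le> und (Omega X) a b" and x: "x \<in> ?X" for x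
  proof -
    \<comment> \<open>The principal element at the pair of \<open>x\<close> and \<open>a\<close> is
      the test that extracts the inequality of values at \<open>x\<close>, by reflexivity of
      \<open>X\<close>.\<close>
    define q where "q = e ?P (pair x a)"
    have q: "q \<in> T ?P"
      unfolding q_def using sm x a by (intro unit_in) auto
    have q2: "Tm ?P ?F pi2 q = e ?F a" and q1: "Tm ?P ?X pi1 q = e ?X x"
      unfolding q_def using sm x a by (simp_all add: Tm_unit pi1_in pi2_in)
    have "\<xi>ext ?P (\<lambda>p. val (pi2 p) (pi1 p)) q = val a x"
      unfolding q_def using sm x a by (simp add: \<xi>ext_unit)
    then have "und (Omega X) a b * str X (e ?X x) x * val a x \<le> val b x"
      using str_OmegaD[OF sm(1) x q, of b] by (simp add: und_def q1 q2)
    moreover have "u * 1 * val a x \<le> und (Omega X) a b * str X (e ?X x) x * val a x"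
      using X x u by (intro quantale_mult_mono order_refl) (auto simp: tgraph_def)
    ultimately show ?thesis
      using order_trans by fastforce
  qed
  moreover have "u \<le> und (Omega X) a b" if u: "\<And>x. x \<in> ?X \<Longrightarrow> u * val a x \<le> val b x"
    unfolding und_def le_str_Omega[OF sm(1)]
  proof (intro ballI impI)
    fix x q assume x: "x \<in> ?X" and q: "q \<in> T ?P" and q2: "Tm ?P ?F pi2 q = e ?F a"
    have "Tm {a} ?F (\<lambda>i. i) (e {a} a) = e ?F a"
      using a sm by (intro Tm_unit) (auto simp: small_singleton)
    then obtain r where r: "r \<in> T (prd ?X {a})"
      and rq: "Tm (prd ?X {a}) ?P (\<lambda>p. pair (pi1 p) (pi2 p)) r = q"
      using Tm_pullback_lift[of ?X "{a}" ?F "\<lambda>i. i" q "e {a} a"] a sm q q2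
        unit_in[of "{a}" a] by (auto simp: small_singleton)
    define t where "t = Tm (prd ?X {a}) ?X pi1 r"
    have sm': "small (prd ?X {a})"
      using sm by (intro small_prd small_singleton)
    have i: "(\<lambda>p. pair (pi1 p) (pi2 p)) \<in> prd ?X {a} \<rightarrow> ?P"
      using a by (auto elim!: prdE)
    have t: "t \<in> T ?X"
      unfolding t_def using sm sm' r pi1_in by (intro Tm_in)
    have q1: "Tm ?P ?X pi1 q = t"
      unfolding t_def rq[symmetric] using sm sm' i r by (simp add: Tm_comp pi1_in)
    have "\<xi>ext ?P (\<lambda>p. val (pi2 p) (pi1 p)) q = \<xi>ext (prd ?X {a}) (\<lambda>p. val (pi2 p) (pi1 p)) r"
      unfolding rq[symmetric] using sm sm' i r by (simp add: \<xi>ext_map)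
    also have "\<dots> = \<xi>ext (prd ?X {a}) (\<lambda>p. val a (pi1 p)) r"
      using sm' r by (intro \<xi>ext_cong) (auto elim!: prdE)
    also have "\<dots> = \<xi>ext ?X (val a) t"
      unfolding t_def using sm sm' r by (simp add: \<xi>ext_map pi1_in)
    finally have ev: "\<xi>ext ?P (\<lambda>p. val (pi2 p) (pi1 p)) q = \<xi>ext ?X (val a) t" .
    have "u * (str X t x * \<xi>ext ?X (val a) t) \<le> u * val a x"
      using Omega_memD(1)[OF sm(1) a] t x by (intro quantale_mult_mono order_refl T_valuedD)
    also have "\<dots> \<le> val b x"
      using u x by simp
    finally show "u * str X (Tm ?P ?X pi1 q) x * \<xi>ext ?P (\<lambda>p. val (pi2 p) (pi1 p)) q \<le> val b x"
      by (simp add: q1 ev mult.assoc)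
  qed
  ultimately show "u \<le> und (Omega X) a b \<longleftrightarrow> u \<le> (INF x\<in>?X. qhom (val a x) (val b x))"
    by (auto simp: le_INF_iff le_qhom)
qed

text \<open>The supremum over \<open>I\<close> is a supremum along the fibres of the projection from
  \<open>prd X I\<close>, with which \<open>\<xi>ext\<close> commutes. It remains to bound the
  contribution of each \<open>r\<close> over \<open>s\<close>, and the structure of
  \<open>Omega X\<close> does this by the value at a single index.\<close>

lemma T_valued_T_sup:
  assumes X: "small (carr X)" and alg: "algebra I \<alpha>" and t: "tmor (alg_graph I \<alpha>) (Omega X) t"
  shows "T_valued X (\<lambda>x. SUP i\<in>I. val (t i) x)" (is "T_valued X ?c")
  unfolding T_valued_def
proof (intro ballI)
  let ?X = "carr X" and ?F = "carr (Omega X)"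
  let ?P = "prd ?X ?F" and ?R = "prd ?X I"
  define ev where "ev p = val (t (pi2 p)) (pi1 p)" for p
  have I: "small I" and \<alpha>: "\<alpha> \<in> T I \<rightarrow> I"
    using alg by (auto simp: algebra_def)
  have tI: "t \<in> I \<rightarrow> ?F"
    using t by (auto simp: tmor_def alg_graph_def)
  have sm: "small ?X" "small ?F" "small ?P" "small ?R" "small I"
    using X I by (auto intro: small_prd small_carr_Omega)
  fix s x assume s: "s \<in> T ?X" and x: "x \<in> ?X"
  have "\<xi>ext ?X ?c s = \<xi>ext ?X (\<lambda>y. Sup {ev p | p. p \<in> ?R \<and> pi1 p = y}) s"
  proof (rule \<xi>ext_cong[OF sm(1) _ s])
    fix y assume y: "y \<in> ?X"
    have "(\<lambda>i. val (t i) y) ` I = {ev p | p. p \<in> ?R \<and> pi1 p = y}"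
    proof (intro equalityI subsetI)
      fix v assume "v \<in> (\<lambda>i. val (t i) y) ` I"
      then obtain i where "i \<in> I" "v = val (t i) y" by blast
      then show "v \<in> {ev p | p. p \<in> ?R \<and> pi1 p = y}"
        using y by (intro CollectI exI[of _ "pair y i"]) (simp add: ev_def)
    qed (auto simp: ev_def elim!: prdE)
    then show "?c y = Sup {ev p | p. p \<in> ?R \<and> pi1 p = y}"
      by simp
  qed
  also have "\<dots> = Sup {\<xi>ext ?R ev r | r. r \<in> T ?R \<and> Tm ?R ?X pi1 r = s}"
    using sm s pi1_in by (intro \<xi>ext_SUP_fibre)
  finally have c: "\<xi>ext ?X ?c s = Sup {\<xi>ext ?R ev r | r. r \<in> T ?R \<and> Tm ?R ?X pi1 r = s}" .
  have "str X s x * \<xi>ext ?R ev r \<le> ?c x" if r: "r \<in> T ?R" and r1: "Tm ?R ?X pi1 r = s" for r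
  proof -
    define i where "i = Tm ?R I pi2 r"
    define q where "q = Tm ?R ?P (\<lambda>p. pair (pi1 p) (t (pi2 p))) r"
    have i: "i \<in> T I"
      unfolding i_def using sm r pi2_in by (intro Tm_in)
    have d: "(\<lambda>p. pair (pi1 p) (t (pi2 p))) \<in> ?R \<rightarrow> ?P"
      using tI by (auto elim!: prdE)
    have q: "q \<in> T ?P"
      unfolding q_def using sm r d by (intro Tm_in)
    have q1: "Tm ?P ?X pi1 q = s"
      unfolding q_def r1[symmetric] using sm r d by (simp add: Tm_comp pi1_in)
    have q2: "Tm ?P ?F pi2 q = Tm I ?F t i"
      unfolding q_def i_def using sm r d tI by (simp add: Tm_comp pi2_in)
    have ev: "\<xi>ext ?P (\<lambda>p. val (pi2 p) (pi1 p)) q = \<xi>ext ?R ev r"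
      unfolding q_def ev_def using sm r d by (simp add: \<xi>ext_map)
    \<comment> \<open>The index \<open>\<alpha> i\<close> bounds this contribution: in the algebra
      \<open>i\<close> converges to \<open>\<alpha> i\<close> with degree \<open>1\<close>, and the
      graph morphism \<open>t\<close> transfers this to \<open>Omega X\<close>.\<close>
    have "\<alpha> i \<in> I" using \<alpha> i by auto
    then have "1 \<le> str (Omega X) (Tm I ?F t i) (t (\<alpha> i))"
      using t i unfolding tmor_def alg_graph_def by force
    then have "1 * str X (Tm ?P ?X pi1 q) x * \<xi>ext ?P (\<lambda>p. val (pi2 p) (pi1 p)) q
      \<le> str (Omega X) (Tm ?P ?F pi2 q) (t (\<alpha> i)) * str X (Tm ?P ?X pi1 q) x *
        \<xi>ext ?P (\<lambda>p. val (pi2 p) (pi1 p)) q"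
      unfolding q2 by (intro quantale_mult_mono order_refl)
    also have "\<dots> \<le> val (t (\<alpha> i)) x"
      by (rule str_OmegaD[OF sm(1) x q])
    also have "\<dots> \<le> ?c x"
      using \<open>\<alpha> i \<in> I\<close> by (rule SUP_upper)
    finally show ?thesis
      by (simp add: q1 ev)
  qed
  then show "str X s x * \<xi>ext ?X ?c s \<le> ?c x"
    unfolding c mult_Sup by (auto intro!: SUP_least)
qed

lemma pointwise_Omega:
  assumes X: "tcat X"
  shows "pointwise_graph \<T> (Omega X) (carr X) (\<lambda>x \<phi>. val \<phi> x)"
proof unfold_locales
  have gr: "tgraph X" and sm: "small (carr X)"
    using X by (auto simp: tcat_def tgraph_def)
  have represent: "\<exists>\<phi>\<in>carr (Omega X). \<forall>x\<in>carr X. val \<phi> x = g x" if "T_valued X g" for g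
    using Omega_memI[OF sm that] val_fn[OF sm] by blast
  show "small (carr (Omega X))"
    using sm by (rule small_carr_Omega)
  show "und (Omega X) a b = (INF s\<in>carr X. qhom (val a s) (val b s))"
    if "a \<in> carr (Omega X)" "b \<in> carr (Omega X)" for a b
    using gr that by (rule und_Omega)
  show "a = b" if a: "a \<in> carr (Omega X)" and b: "b \<in> carr (Omega X)"
    and eq: "\<And>s. s \<in> carr X \<Longrightarrow> val a s = val b s" for a b
  proof -
    have "app a s = app b s" if "s \<in> carr X" for s
      using eq[OF that] Omega_memD(3)[OF sm a that] Omega_memD(3)[OF sm b that] by (metis en_de)
    then have "fn (carr X) (app a) = fn (carr X) (app b)"
      by (rule fn_cong)
    then show ?thesis
      using Omega_memD(2)[OF sm a] Omega_memD(2)[OF sm b] by simp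
  qed
  show "\<exists>\<rho>\<in>carr (Omega X). \<forall>a\<in>carr (Omega X). und (Omega X) \<rho> a = val a s"
    if s: "s \<in> carr X" for s
  proof -
    obtain \<rho> where \<rho>: "\<rho> \<in> carr (Omega X)" "\<And>x. x \<in> carr X \<Longrightarrow> val \<rho> x = str X (e (carr X) s) x"
      using represent[OF T_valued_representable[OF X s]] by blast
    have "und (Omega X) \<rho> a = val a s" if a: "a \<in> carr (Omega X)" for a
    \<comment> \<open>The first bound evaluates at \<open>s\<close>, where \<open>\<rho>\<close> is
      at least \<open>1\<close>. The second holds because a functor into \<open>V\<close> respects
      the underlying hom-objects of \<open>X\<close>.\<close>
    proof (rule antisym)
      have "und (Omega X) \<rho> a * 1 \<le> qhom (val \<rho> s) (val a s) * val \<rho> s"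
        using s \<rho> gr unfolding und_Omega[OF gr \<rho>(1) a]
        by (intro quantale_mult_mono) (auto simp: tgraph_def intro: INF_lower)
      also have "\<dots> \<le> val a s"
        using le_qhom by blast
      finally show "und (Omega X) \<rho> a \<le> val a s" by simp
      have "val a s * str X (e (carr X) s) x \<le> val a x" if "x \<in> carr X" for x
        using T_valued_unit[OF sm Omega_memD(1)[OF sm a] s that] by (simp add: mult.commute)
      then show "val a s \<le> und (Omega X) \<rho> a"
        unfolding und_Omega[OF gr \<rho>(1) a] by (simp add: le_INF_iff le_qhom \<rho>)
    qed
    with \<rho> show ?thesis by blast
  qed
  show "\<exists>l\<in>carr (Omega X). \<forall>s\<in>carr X. val l s = (INF i\<in>I. qhom (w i) (val (h i) s))"
    if "h \<in> I \<rightarrow> carr (Omega X)" for h w and I :: "'u set"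
    using that sm by (intro represent T_valued_lim Omega_memD) auto
  show "\<exists>t\<in>carr (Omega X). \<forall>s\<in>carr X. val t s = v * val a s" if "a \<in> carr (Omega X)" for a v
    using that sm by (intro represent T_valued_tensor Omega_memD) auto
  show "\<exists>c\<in>carr (Omega X). \<forall>s\<in>carr X. val c s = (SUP i\<in>I. val (t i) s)"
    if "algebra I \<alpha>" "tmor (alg_graph I \<alpha>) (Omega X) t" for I \<alpha> t
    using that sm by (intro represent T_valued_T_sup)
qed

section \<open>Evaluation and precomposition as frame homomorphisms\<close>

text \<open>Pairing with \<open>x\<close> sends \<open>p\<close> to a test element over
  \<open>p\<close> whose projection to \<open>T X\<close> comes from a constant map, hence is
  \<open>e x\<close>. Reflexivity of \<open>X\<close> at \<open>x\<close> then removes the factor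
  contributed by the structure of \<open>X\<close>.\<close>

lemma tmor_eval:
  assumes X: "tgraph X" and x: "x \<in> carr X"
  shows "tmor (Omega X) Vobj (\<lambda>\<phi>. app \<phi> x)"
proof -
  let ?X = "carr X" and ?F = "carr (Omega X)"
  let ?P = "prd ?X ?F"
  have sm: "small ?X" "small ?F" "small ?P"
    using X by (auto simp: tgraph_def intro: small_prd small_carr_Omega)
  have "str (Omega X) p \<phi> * \<xi>ext ?F (\<lambda>\<phi>. val \<phi> x) p \<le> val \<phi> x" if p: "p \<in> T ?F" for p \<phi>
  proof -
    define q where "q = Tm ?F ?P (pair x) p"
    have d: "pair x \<in> ?F \<rightarrow> ?P"
      using x by auto
    have q: "q \<in> T ?P"
      unfolding q_def using sm d p by (intro Tm_in)
    have q1: "Tm ?P ?X pi1 q = e ?X x"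
      unfolding q_def using sm d p x by (simp add: Tm_comp pi1_in Tm_const)
    have q2: "Tm ?P ?F pi2 q = p"
      unfolding q_def using sm d p by (simp add: Tm_comp pi2_in Tm_id)
    have ev: "\<xi>ext ?P (\<lambda>p. val (pi2 p) (pi1 p)) q = \<xi>ext ?F (\<lambda>\<phi>. val \<phi> x) p"
      unfolding q_def using sm d p by (simp add: \<xi>ext_map)
    let ?u = "str (Omega X) p \<phi>"
    have "?u * 1 * \<xi>ext ?F (\<lambda>\<phi>. val \<phi> x) p \<le> ?u * str X (e ?X x) x * \<xi>ext ?F (\<lambda>\<phi>. val \<phi> x) p"
      using X x by (intro quantale_mult_mono order_refl) (auto simp: tgraph_def)
    also have "\<dots> \<le> val \<phi> x"
      using str_OmegaD[OF sm(1) x q, of \<phi>] by (simp only: q1 q2 ev)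
    finally show ?thesis by simp
  qed
  then show ?thesis
    using sm x Omega_memD(3)[OF sm(1)] by (auto simp: tmor_Vobj_iff T_valued_def)
qed

lemma app_Omega_map: "small (carr X) \<Longrightarrow> x \<in> carr X \<Longrightarrow> app (Omega_map X f \<phi>) x = app \<phi> (f x)"
  by (simp add: Omega_map_def app_fn)

lemma Omega_map_in:
  assumes X: "small (carr X)" and Y: "small (carr Y)" and f: "tmor X Y f" and \<phi>: "\<phi> \<in> carr (Omega Y)"
  shows "Omega_map X f \<phi> \<in> carr (Omega X)"
proof -
  have fX: "f \<in> carr X \<rightarrow> carr Y"
    using f by (simp add: tmor_def)
  have "str X t x * \<xi>ext (carr X) (\<lambda>x. val \<phi> (f x)) t \<le> val \<phi> (f x)"
    if t: "t \<in> T (carr X)" and x: "x \<in> carr X" for t x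
  proof -
    have ft: "Tm (carr X) (carr Y) f t \<in> T (carr Y)"
      using X Y fX t by (intro Tm_in)
    have "\<xi>ext (carr X) (\<lambda>x. val \<phi> (f x)) t = \<xi>ext (carr Y) (val \<phi>) (Tm (carr X) (carr Y) f t)"
      using X Y fX t by (simp add: \<xi>ext_map)
    then have "str X t x * \<xi>ext (carr X) (\<lambda>x. val \<phi> (f x)) t
      \<le> str Y (Tm (carr X) (carr Y) f t) (f x) * \<xi>ext (carr Y) (val \<phi>) (Tm (carr X) (carr Y) f t)"
      using f t x by (intro quantale_mult_mono) (auto simp: tmor_def)
    also have "\<dots> \<le> val \<phi> (f x)"
      using Omega_memD(1)[OF Y \<phi>] ft fX x by (intro T_valuedD) auto
    finally show ?thesis .
  qed
  then have "fn (carr X) (\<lambda>x. en (val \<phi> (f x))) \<in> carr (Omega X)"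
    using X by (intro Omega_memI) (auto simp: T_valued_def)
  moreover have "fn (carr X) (\<lambda>x. en (val \<phi> (f x))) = Omega_map X f \<phi>"
    unfolding Omega_map_def using Omega_memD(3)[OF Y \<phi>] fX by (intro fn_cong en_de) auto
  ultimately show ?thesis by simp
qed

text \<open>A test element for \<open>Omega X\<close> over the image of \<open>p\<close> lifts, by
  the weak pullback property, to \<open>r\<close> in \<open>T (X \<times> Omega Y)\<close>. Applying
  \<open>f\<close> in the first component gives a test element for \<open>Omega Y\<close> over
  \<open>p\<close> with the same evaluation.\<close>

lemma tmor_Omega_map:
  assumes X: "small (carr X)" and Y: "small (carr Y)" and f: "tmor X Y f"
  shows "tmor (Omega Y) (Omega X) (Omega_map X f)"
  unfolding tmor_def
proof (intro conjI ballI)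
  let ?X = "carr X" and ?Y = "carr Y" and ?F = "carr (Omega X)" and ?G = "carr (Omega Y)"
  let ?P = "prd ?X ?F" and ?Q = "prd ?Y ?G" and ?R = "prd ?X ?G" and ?f = "Omega_map X f"
  have sm: "small ?X" "small ?Y" "small ?F" "small ?G" "small ?P" "small ?Q" "small ?R"
    using X Y by (auto intro: small_prd small_carr_Omega)
  have fX: "f \<in> ?X \<rightarrow> ?Y"
    using f by (simp add: tmor_def)
  show fG: "?f \<in> ?G \<rightarrow> ?F"
    using Omega_map_in[OF X Y f] by auto
  fix p \<phi> assume p: "p \<in> T ?G" and \<phi>: "\<phi> \<in> ?G"
  show "str (Omega Y) p \<phi> \<le> str (Omega X) (Tm ?G ?F ?f p) (?f \<phi>)"
    unfolding le_str_Omega[OF X]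
  proof (intro ballI impI)
    fix x q assume x: "x \<in> ?X" and q: "q \<in> T ?P" and q2: "Tm ?P ?F pi2 q = Tm ?G ?F ?f p"
    obtain r where r: "r \<in> T ?R"
      and rq: "Tm ?R ?P (\<lambda>p. pair (pi1 p) (?f (pi2 p))) r = q" and r2: "Tm ?R ?G pi2 r = p"
      using Tm_pullback_lift[OF sm(1) sm(4) sm(3) fG q p q2] .
    define q' where "q' = Tm ?R ?Q (\<lambda>p. pair (f (pi1 p)) (pi2 p)) r"
    have d: "(\<lambda>p. pair (pi1 p) (?f (pi2 p))) \<in> ?R \<rightarrow> ?P" "(\<lambda>p. pair (f (pi1 p)) (pi2 p)) \<in> ?R \<rightarrow> ?Q"
      using fG fX by (auto elim!: prdE)
    have q': "q' \<in> T ?Q"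
      unfolding q'_def using sm d r by (intro Tm_in)
    have q'2: "Tm ?Q ?G pi2 q' = p"
      unfolding q'_def r2[symmetric] using sm d r by (simp add: Tm_comp pi2_in)
    have q1: "Tm ?P ?X pi1 q = Tm ?R ?X pi1 r"
      unfolding rq[symmetric] using sm d r by (simp add: Tm_comp pi1_in)
    have q1_in: "Tm ?P ?X pi1 q \<in> T ?X"
      using sm q pi1_in by (intro Tm_in)
    have q'1: "Tm ?Q ?Y pi1 q' = Tm ?X ?Y f (Tm ?P ?X pi1 q)"
      unfolding q'_def q1 using sm d r fX by (simp add: Tm_comp pi1_in)
    have "\<xi>ext ?P (\<lambda>p. val (pi2 p) (pi1 p)) q = \<xi>ext ?R (\<lambda>p. val (?f (pi2 p)) (pi1 p)) r"
      unfolding rq[symmetric] using sm d r by (simp add: \<xi>ext_map)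
    also have "\<dots> = \<xi>ext ?R (\<lambda>p. val (pi2 p) (f (pi1 p))) r"
      using sm r by (intro \<xi>ext_cong) (auto simp: app_Omega_map elim!: prdE)
    also have "\<dots> = \<xi>ext ?Q (\<lambda>p. val (pi2 p) (pi1 p)) q'"
      unfolding q'_def using sm d r by (simp add: \<xi>ext_map)
    finally have ev: "\<xi>ext ?P (\<lambda>p. val (pi2 p) (pi1 p)) q = \<xi>ext ?Q (\<lambda>p. val (pi2 p) (pi1 p)) q'" .
    let ?u = "str (Omega Y) p \<phi>"
    have "str X (Tm ?P ?X pi1 q) x \<le> str Y (Tm ?Q ?Y pi1 q') (f x)"
      using f q1_in x unfolding q'1 tmor_def by blast
    then have "?u * str X (Tm ?P ?X pi1 q) x * \<xi>ext ?P (\<lambda>p. val (pi2 p) (pi1 p)) q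
      \<le> ?u * str Y (Tm ?Q ?Y pi1 q') (f x) * \<xi>ext ?Q (\<lambda>p. val (pi2 p) (pi1 p)) q'"
      unfolding ev by (intro quantale_mult_mono order_refl)
    also have "\<dots> \<le> val \<phi> (f x)"
      using str_OmegaD[OF Y _ q', of "f x" \<phi>] fX x by (simp add: q'2 Pi_iff)
    finally show "?u * str X (Tm ?P ?X pi1 q) x * \<xi>ext ?P (\<lambda>p. val (pi2 p) (pi1 p)) q
      \<le> val (?f \<phi>) x"
      using X x by (simp add: app_Omega_map)
  qed
qed

text \<open>The single evaluation of \<open>V\<close> is indexed by \<open>x\<close> itself, so the
  reindexing is the inclusion of this point into \<open>X\<close>.\<close>

lemma frame_hom_eval:
  assumes X: "tcat X" and x: "x \<in> carr X"
  shows "frame_hom (Omega X) Vobj (\<lambda>\<phi>. app \<phi> x)"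
  by (rule frame_hom_pointwise[OF pointwise_Omega[OF X] pointwise_Vobj[of x] tmor_eval, of x "\<lambda>s. s"])
    (use X x in \<open>auto simp: tcat_def\<close>)

text \<open>Evaluation at \<open>x\<close> after precomposition with \<open>f\<close> is evaluation
  at \<open>f x\<close>, so \<open>f\<close> also serves as the reindexing of evaluations.\<close>

lemma frame_hom_comp_Omega_map:
  assumes X: "tcat X" and Y: "tcat Y" and f: "tmor X Y f" and g: "frame_hom (Omega X) C g"
  shows "frame_hom (Omega Y) C (\<lambda>\<phi>. g (Omega_map X f \<phi>))"
  by (rule frame_hom_comp_pointwise[OF pointwise_Omega[OF Y] pointwise_Omega[OF X] tmor_Omega_map _ _ g,
        of f f])
    (use X Y f in \<open>auto simp: tcat_def tgraph_def app_Omega_map tmor_def\<close>)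


section \<open>The space of points\<close>

lemma pt_carr_app:
  assumes "small (carr A)" "h \<in> pt_carr A"
  shows "x \<in> carr A \<Longrightarrow> app h x \<in> VV" and "h = fn (carr A) (app h)" and "frame_hom A Vobj (app h)"
proof -
  obtain g where g: "frame_hom A Vobj g" "h = fn (carr A) g"
    using assms by (auto simp: pt_carr_def)
  then have app: "app h x = g x" if "x \<in> carr A" for x
    using assms that by (simp add: app_fn)
  have "g \<in> carr A \<rightarrow> VV"
    using g(1) unfolding frame_hom_def vfunctor_def by (simp add: Vobj_def)
  then show "x \<in> carr A \<Longrightarrow> app h x \<in> VV"
    by (auto simp: app)
  show "h = fn (carr A) (app h)"
    using g(2) app fn_cong[of "carr A" "app h" g] by simp
  show "frame_hom A Vobj (app h)"
    using g(1) by (rule frame_hom_cong) (simp add: app)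
qed

lemma small_pt_carr:
  assumes "small (carr A)"
  shows "small (pt_carr A)"
proof -
  have "h \<in> {fn (carr A) f | f. f \<in> carr A \<rightarrow> VV}" if "h \<in> pt_carr A" for h
    using pt_carr_app[OF assms that] by blast
  then show ?thesis
    using small_fn_space[OF assms small_VV] small_subset by blast
qed

text \<open>The initial structure with respect to all evaluations into \<open>V\<close>, an explicit
  form of the structure chosen in \<open>pt\<close>.\<close>

definition pt_str :: "('u, 'v) tgraph \<Rightarrow> 'u \<Rightarrow> 'u \<Rightarrow> 'v" where
  "pt_str A t h = (INF x\<in>carr A. qhom (\<xi>ext (pt_carr A) (\<lambda>h. val h x) t) (val h x))"

lemma le_pt_str:
  "u \<le> pt_str A t h \<longleftrightarrow> (\<forall>x\<in>carr A. u * \<xi>ext (pt_carr A) (\<lambda>h. val h x) t \<le> val h x)"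
  by (simp add: pt_str_def le_INF_iff le_qhom)

text \<open>The composition law is checked at one evaluation at a time: \<open>\<xi>ext_mult\<close>
  resolves the multiplication \<open>m\<close>, \<open>\<xi>ext_times\<close> joins the two factors
  over an element \<open>w\<close>, and the bound defining \<open>pt_str\<close> applies under the
  monotone \<open>\<xi>ext\<close>.\<close>

lemma pt_admissible_pt_str:
  assumes A: "small (carr A)"
  shows "pt_admissible A (pt_str A)"
proof -
  let ?P = "pt_carr A"
  let ?W = "prd (T ?P) ?P"
  have sm: "small ?P" "small (T ?P)" "small ?W"
    using small_pt_carr[OF A] by (auto intro: small_T small_prd)
  have D: "pt_str A t h * \<xi>ext ?P (\<lambda>h. val h x) t \<le> val h x" if "x \<in> carr A" for t h x
    using le_pt_str[of "pt_str A t h" A t h] that by simp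
  have "tmor \<lparr>carr = ?P, str = pt_str A\<rparr> Vobj (\<lambda>h. app h x)" if "x \<in> carr A" for x
    using sm that D pt_carr_app(1)[OF A] by (auto simp: tmor_Vobj_iff T_valued_def)
  moreover have "1 \<le> pt_str A (e ?P h) h" if "h \<in> ?P" for h
    using that sm by (simp add: le_pt_str \<xi>ext_unit)
  moreover have "Txi (T ?P) ?P (pt_str A) tt t * pt_str A t h \<le> pt_str A (m ?P tt) h"
    if tt: "tt \<in> T (T ?P)" and t: "t \<in> T ?P" for tt t h
    unfolding le_pt_str
  proof
    fix x assume x: "x \<in> carr A"
    define ev where "ev = (\<lambda>h. val h x)"
    have "\<xi>ext ?P ev (m ?P tt) * \<xi>ext ?W (\<lambda>p. pt_str A (pi1 p) (pi2 p)) w \<le> \<xi>ext ?P ev t"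
      if w: "w \<in> T ?W" and w1: "Tm ?W (T ?P) pi1 w = tt" and w2: "Tm ?W ?P pi2 w = t" for w
    proof -
      have "\<xi>ext ?P ev (m ?P tt) = \<xi>ext ?W (\<lambda>p. \<xi>ext ?P ev (pi1 p)) w"
        using sm tt w by (simp add: \<xi>ext_mult) (simp add: w1[symmetric] \<xi>ext_map pi1_in)
      then have "\<xi>ext ?P ev (m ?P tt) * \<xi>ext ?W (\<lambda>p. pt_str A (pi1 p) (pi2 p)) w =
        \<xi>ext ?W (\<lambda>p. \<xi>ext ?P ev (pi1 p) * pt_str A (pi1 p) (pi2 p)) w"
        using sm w by (simp add: \<xi>ext_times)
      also have "\<dots> \<le> \<xi>ext ?W (\<lambda>p. ev (pi2 p)) w"
        using sm w D[OF x] by (intro \<xi>ext_mono) (auto simp: ev_def mult.commute)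
      also have "\<dots> = \<xi>ext ?P ev t"
        using sm w by (simp add: w2[symmetric] \<xi>ext_map pi2_in)
      finally show ?thesis .
    qed
    then have "\<xi>ext ?P ev (m ?P tt) * Txi (T ?P) ?P (pt_str A) tt t \<le> \<xi>ext ?P ev t"
      unfolding Txi_def mult_Sup by (auto intro!: SUP_least)
    then have "pt_str A t h * (\<xi>ext ?P ev (m ?P tt) * Txi (T ?P) ?P (pt_str A) tt t)
      \<le> pt_str A t h * \<xi>ext ?P ev t"
      by (intro quantale_mult_mono order_refl)
    also have "\<dots> \<le> val h x"
      unfolding ev_def using x by (rule D)
    finally show "Txi (T ?P) ?P (pt_str A) tt t * pt_str A t h * \<xi>ext ?P (\<lambda>h. val h x) (m ?P tt)
      \<le> val h x"
      by (simp add: ev_def ac_simps)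
  qed
  ultimately show ?thesis
    using sm unfolding pt_admissible_def tcat_def tgraph_def by simp
qed

lemma pt_admissible_le:
  assumes A: "small (carr A)" and c: "pt_admissible A c" and t: "t \<in> T (pt_carr A)" and h: "h \<in> pt_carr A"
  shows "c t h \<le> pt_str A t h"
  unfolding le_pt_str
proof
  fix x assume "x \<in> carr A"
  then have "tmor \<lparr>carr = pt_carr A, str = c\<rparr> Vobj (\<lambda>h. app h x)"
    using c by (simp add: pt_admissible_def)
  then show "c t h * \<xi>ext (pt_carr A) (\<lambda>h. val h x) t \<le> val h x"
    using t h small_pt_carr[OF A] by (simp add: tmor_Vobj_iff T_valued_def)
qed

lemma carr_pt: "carr (pt A) = pt_carr A"
  and pt_eta: "\<lparr>carr = pt_carr A, str = str (pt A)\<rparr> = pt A"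
  by (simp_all add: pt_def)

text \<open>The structure in \<open>pt\<close> is given by choice. Since \<open>pt_str\<close> is
  admissible and dominates every admissible structure, the choice is justified, and antisymmetry
  identifies the two on the relevant arguments.\<close>

lemma
  assumes A: "small (carr A)"
  shows pt_admissible_pt: "pt_admissible A (str (pt A))"
    and str_pt: "t \<in> T (pt_carr A) \<Longrightarrow> h \<in> pt_carr A \<Longrightarrow> str (pt A) t h = pt_str A t h"
proof -
  let ?Q = "\<lambda>c. pt_admissible A c \<and>
       (\<forall>c'. pt_admissible A c' \<longrightarrow> (\<forall>t\<in>T (pt_carr A). \<forall>h\<in>pt_carr A. c' t h \<le> c t h))"
  have "?Q (pt_str A)"
    using pt_admissible_pt_str[OF A] pt_admissible_le[OF A] by blast
  then have "?Q (SOME c. ?Q c)"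
    by (rule someI[of ?Q])
  then have *: "?Q (str (pt A))"
    by (simp add: pt_def)
  then show "pt_admissible A (str (pt A))" by blast
  show "str (pt A) t h = pt_str A t h" if "t \<in> T (pt_carr A)" "h \<in> pt_carr A"
    using * that pt_admissible_pt_str[OF A] pt_admissible_le[OF A] by (intro antisym) auto
qed

section \<open>Initiality of \<open>pt\<close> and its action on maps\<close>

lemma tcat_pt:
  assumes "small (carr A)"
  shows "tcat (pt A)"
  using pt_admissible_pt[OF assms] unfolding pt_admissible_def pt_eta by simp

lemma tmor_pt_eval:
  assumes "small (carr A)" "x \<in> carr A"
  shows "tmor (pt A) Vobj (\<lambda>h. app h x)"
  using pt_admissible_pt[OF assms(1)] assms(2) unfolding pt_admissible_def pt_eta by simp

text \<open>A bound by \<open>pt_str\<close> is one inequality for each evaluation, and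
  \<open>\<xi>ext_map\<close> turns the one at \<open>a\<close> into functoriality of the composite
  of \<open>f\<close> with evaluation at \<open>a\<close>.\<close>

lemma tmor_into_pt:
  assumes A: "small (carr A)" and X: "small (carr X)" and f: "f \<in> carr X \<rightarrow> pt_carr A"
    and ev: "\<And>a. a \<in> carr A \<Longrightarrow> tmor X Vobj (\<lambda>x. app (f x) a)"
  shows "tmor X (pt A) f"
  unfolding tmor_def carr_pt
proof (intro conjI ballI f)
  fix t x assume t: "t \<in> T (carr X)" and x: "x \<in> carr X"
  note P = small_pt_carr[OF A]
  have ft: "Tm (carr X) (pt_carr A) f t \<in> T (pt_carr A)"
    using X P f t by (intro Tm_in)
  have "str X t x * \<xi>ext (carr X) (\<lambda>x. val (f x) a) t \<le> val (f x) a" if "a \<in> carr A" for a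
    using ev[OF that] X t x by (simp add: tmor_Vobj_iff T_valued_def)
  then have "str X t x \<le> pt_str A (Tm (carr X) (pt_carr A) f t) (f x)"
    using X P f t by (simp add: le_pt_str \<xi>ext_map)
  then show "str X t x \<le> str (pt A) (Tm (carr X) (pt_carr A) f t) (f x)"
    using str_pt[OF A ft, of "f x"] f x by (simp add: Pi_iff)
qed

lemma pt_map_Omega_map_in:
  assumes X: "tcat X" and Y: "tcat Y" and f: "tmor X Y f" and p: "p \<in> pt_carr (Omega X)"
  shows "pt_map (Omega Y) (Omega_map X f) p \<in> pt_carr (Omega Y)"
proof -
  have "small (carr X)"
    using X by (simp add: tcat_def tgraph_def)
  then have "frame_hom (Omega X) Vobj (app p)"
    using p by (intro pt_carr_app(3) small_carr_Omega)
  then show ?thesis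
    using frame_hom_comp_Omega_map[OF X Y f] unfolding pt_map_def pt_carr_def by blast
qed

lemma tmor_pt_map:
  assumes X: "tcat X" and Y: "tcat Y" and f: "tmor X Y f"
  shows "tmor (pt (Omega X)) (pt (Omega Y)) (pt_map (Omega Y) (Omega_map X f))" (is "tmor _ _ ?g")
proof -
  have sm: "small (carr X)" "small (carr Y)" "small (carr (Omega X))" "small (carr (Omega Y))"
    using X Y by (auto simp: tcat_def tgraph_def intro: small_carr_Omega)
  have P: "small (carr (pt (Omega X)))"
    using sm by (simp add: carr_pt small_pt_carr)
  show ?thesis
  proof (rule tmor_into_pt[OF sm(4) P])
    show "?g \<in> carr (pt (Omega X)) \<rightarrow> pt_carr (Omega Y)"
      using pt_map_Omega_map_in[OF X Y f] by (auto simp: carr_pt)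
    fix a assume a: "a \<in> carr (Omega Y)"
    \<comment> \<open>Evaluation at \<open>a\<close> after \<open>?g\<close> is again an evaluation,
      now at \<open>Omega_map X f a\<close>.\<close>
    then have "tmor (pt (Omega X)) Vobj (\<lambda>h. app h (Omega_map X f a))"
      using sm f by (intro tmor_pt_eval Omega_map_in)
    then show "tmor (pt (Omega X)) Vobj (\<lambda>h. app (?g h) a)"
      using sm(4) a by (simp add: pt_map_def app_fn)
  qed
qed

section \<open>Functoriality and naturality\<close>

lemma endofunctor_pt_Omega:
  "endofunctor (\<lambda>X. pt (Omega X)) (\<lambda>X Y f. pt_map (Omega Y) (Omega_map X f))"
  unfolding endofunctor_def
proof (intro conjI allI impI ballI)
  fix X assume X: "tcat X"
  have sm: "small (carr X)" "small (carr (Omega X))"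
    using X by (auto simp: tcat_def tgraph_def intro: small_carr_Omega)
  then show "tcat (pt (Omega X))"
    by (intro tcat_pt)
  fix p assume p: "p \<in> carr (pt (Omega X))"
  have "Omega_map X (\<lambda>x. x) \<phi> = \<phi>" if "\<phi> \<in> carr (Omega X)" for \<phi>
    using Omega_memD(2)[OF sm(1) that] by (simp add: Omega_map_def)
  then have "pt_map (Omega X) (Omega_map X (\<lambda>x. x)) p = fn (carr (Omega X)) (app p)"
    unfolding pt_map_def by (intro fn_cong) simp
  then show "pt_map (Omega X) (Omega_map X (\<lambda>x. x)) p = p"
    using pt_carr_app(2)[OF sm(2)] p by (simp add: carr_pt)
next
  fix X Y f g p
  assume "tcat X \<and> tcat Y \<and> tmor X Y f \<and> tmor X Y g \<and> (\<forall>x\<in>carr X. f x = g x)"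
  \<comment> \<open>Full equality holds although the maps agree only on the carrier, because the
    codes in \<open>Omega_map\<close> record values on \<open>carr X\<close> alone.\<close>
  then have "Omega_map X f = Omega_map X g"
    unfolding Omega_map_def by (intro ext fn_cong) simp
  then show "pt_map (Omega Y) (Omega_map X f) p = pt_map (Omega Y) (Omega_map X g) p"
    by simp
next
  fix X Y f assume "tcat X \<and> tcat Y \<and> tmor X Y f"
  then show "tmor (pt (Omega X)) (pt (Omega Y)) (pt_map (Omega Y) (Omega_map X f))"
    by (intro tmor_pt_map) auto
next
  fix X Y Z f g p
  assume *: "tcat X \<and> tcat Y \<and> tcat Z \<and> tmor X Y f \<and> tmor Y Z g"
  then have sm: "small (carr X)" "small (carr Y)" "small (carr Z)" "small (carr (Omega Y))"
    by (auto simp: tcat_def tgraph_def intro: small_carr_Omega)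
  have "app p (Omega_map X (\<lambda>x. g (f x)) \<phi>)
    = app (pt_map (Omega Y) (Omega_map X f) p) (Omega_map Y g \<phi>)" if \<phi>: "\<phi> \<in> carr (Omega Z)" for \<phi>
  proof -
    have "Omega_map X (\<lambda>x. g (f x)) \<phi> = Omega_map X f (Omega_map Y g \<phi>)"
      unfolding Omega_map_def[of X] using * sm
      by (intro fn_cong) (auto simp: app_Omega_map tmor_def Pi_iff)
    moreover have "Omega_map Y g \<phi> \<in> carr (Omega Y)"
      using * sm \<phi> by (intro Omega_map_in) auto
    ultimately show ?thesis
      using sm by (simp add: pt_map_def app_fn)
  qed
  then show "pt_map (Omega Z) (Omega_map X (\<lambda>x. g (f x))) p
    = pt_map (Omega Z) (Omega_map Y g) (pt_map (Omega Y) (Omega_map X f) p)"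
    unfolding pt_map_def[of "Omega Z"] by (rule fn_cong)
qed

text \<open>The components take values in points by \<open>frame_hom_eval\<close>. Naturality
  compares two codes on \<open>Omega Y\<close>, whose values at \<open>\<phi>\<close> are both
  \<open>\<phi>\<close> at \<open>f x\<close>.\<close>

lemma eval_natural_transformation:
  "natural_transformation (\<lambda>X. X) (\<lambda>X Y f. f)
     (\<lambda>X. pt (Omega X)) (\<lambda>X Y f. pt_map (Omega Y) (Omega_map X f))
     (\<lambda>X x. fn (carr (Omega X)) (\<lambda>\<phi>. app \<phi> x))"
  unfolding natural_transformation_def
proof (intro conjI allI impI ballI endofunctor_pt_Omega)
  show "endofunctor (\<lambda>X. X) (\<lambda>X Y f. f)"
    by (auto simp: endofunctor_def)
next
  fix X assume X: "tcat X"
  have sm: "small (carr X)" "small (carr (Omega X))"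
    using X by (auto simp: tcat_def tgraph_def intro: small_carr_Omega)
  show "tmor X (pt (Omega X)) (\<lambda>x. fn (carr (Omega X)) (\<lambda>\<phi>. app \<phi> x))"
  proof (rule tmor_into_pt[OF sm(2) sm(1)])
    show "(\<lambda>x. fn (carr (Omega X)) (\<lambda>\<phi>. app \<phi> x)) \<in> carr X \<rightarrow> pt_carr (Omega X)"
      using frame_hom_eval[OF X] unfolding pt_carr_def by blast
    fix a assume a: "a \<in> carr (Omega X)"
    \<comment> \<open>The composite of the component with evaluation at \<open>a\<close> is
      \<open>a\<close> itself, a functor since it belongs to \<open>Omega X\<close>.\<close>
    then show "tmor X Vobj (\<lambda>x. app (fn (carr (Omega X)) (\<lambda>\<phi>. app \<phi> x)) a)"
      using sm Omega_memD[OF sm(1) a] by (simp add: app_fn tmor_Vobj_iff)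
  qed
next
  fix X Y f x
  assume *: "tcat X \<and> tcat Y \<and> tmor X Y f" and x: "x \<in> carr X"
  then have sm: "small (carr X)" "small (carr Y)" "small (carr (Omega X))"
    by (auto simp: tcat_def tgraph_def intro: small_carr_Omega)
  show "fn (carr (Omega Y)) (\<lambda>\<phi>. app \<phi> (f x))
    = pt_map (Omega Y) (Omega_map X f) (fn (carr (Omega X)) (\<lambda>\<phi>. app \<phi> x))"
    unfolding pt_map_def
  proof (rule fn_cong)
    fix \<phi> assume "\<phi> \<in> carr (Omega Y)"
    then have "Omega_map X f \<phi> \<in> carr (Omega X)"
      using * sm by (intro Omega_map_in) auto
    then show "app \<phi> (f x) = app (fn (carr (Omega X)) (\<lambda>\<phi>. app \<phi> x)) (Omega_map X f \<phi>)"
      using sm x by (simp add: app_fn app_Omega_map)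
  qed
qed

end

theorem proposition2p12:
  fixes \<T> :: "('u::set_universe, 'v::comm_quantale) theory_data"
  assumes "T_data.strict_theory \<T>"
    and "T_data.T_one_eq_one \<T>"
  shows "T_data.natural_transformation \<T>
           (\<lambda>X. X)
           (\<lambda>X Y f. f)
           (\<lambda>X. T_data.pt \<T> (T_data.Omega \<T> X))
           (\<lambda>X Y f. T_data.pt_map (T_data.Omega \<T> Y) (T_data.Omega_map X f))
           (\<lambda>X x. fn (carr (T_data.Omega \<T> X)) (\<lambda>\<phi>. app \<phi> x))"
proof -
  interpret strict_topological_theory \<T>
    by unfold_locales (use assms in blast)+
  show ?thesis
    by (rule eval_natural_transformation)
qed

end
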